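(* Let $H$ be a Hopf $*$-algebra over $\mathbb{C}$ and let $\mathcal C$ be a sub-monoidal category of the category $\mathbf{HMod}$ of left $H$-modules, equipped with a braiding $\psi=(\psi_{VW})_{V,W\in\mathcal C}$. Suppose that $\mathcal C$ is closed under complex conjugation, i.e. $\overline V\in\mathcal C$ for every object $V$ of $\mathcal C$ and $\overline f$ is a morphism in $\mathcal C$ for every morphism $f$ in $\mathcal C$, and that for all objects $V,W$ of $\mathcal C$ the isomorphisms $\rho_{VW}:\overline{V\otimes W}\to\overline W\otimes\overline V$, $\overline{v\otimes w}\mapsto\bar w\otimes\bar v$, and $\sigma_V:\overline{\overline V}\to V$, $\bar{\bar v}\mapsto v$, along with their inverses, are morphisms in $\mathcal C$. Then the conjugate braiding $\overline\psi=(\overline\psi_{XY})_{X,Y\in\mathcal C}$ is a braiding on $\mathcal C$.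
   Context: All vector spaces are over $\mathbb{C}$; associators for tensor products are suppressed. A Hopf $*$-algebra is a Hopf algebra $H$ over $\mathbb{C}$ (coproduct $\Delta(a)=a_{(1)}\otimes a_{(2)}$, counit $\varepsilon$, antipode $S$) equipped with an antilinear map $*:H\to H$ such that $(a^* )^*=a$, $(ab)^*=b^*a^*$ and $\Delta(a^* )=a_{(1)}^*\otimes a_{(2)}^*$. $\mathbf{HMod}$ is monoidal with unit $\mathbb{C}$ (a module via $\varepsilon$) and $a\rhd(v\otimes w)=(a_{(1)}\rhd v)\otimes(a_{(2)}\rhd w)$. For a vector space $V$, the complex conjugate vector space $\overline{V}$ consists of formal symbols $\bar v$ ($v\in V$) with $\bar v+\bar w=\overline{v+w}$ and $\lambda\cdot\bar v=\overline{\bar\lambda v}$. For a linear map $T:V\to W$, $\overline T(\bar v)=\overline{T(v)}$. If $V$ is a left $H$-module, $\overline V$ is a left $H$-module via $a\rhd\bar v=\overline{S(a)^*\rhd v}$. A sub-monoidal category $\mathcal C$ of $\mathbf{HMod}$ is a subcategory containing $\mathbb{C}$ and closed under tensor products (of objects and of morphisms). A braiding on $\mathcal C$ is a collection of isomorphisms $\psi_{VW}:V\otimes W\to W\otimes V$ in $\mathcal C$, for all $V,W\in\mathcal C$, such that for all $U,V,W\in\mathcal C$ $$\psi_{U,V\otimes W}=(\mathrm{id}_V\otimes\psi_{UW})(\psi_{UV}\otimes\mathrm{id}_W),\qquad\psi_{U\otimes V,W}=(\psi_{UW}\otimes\mathrm{id}_V)(\mathrm{id}_U\otimes\psi_{VW}),$$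 and such that for all morphisms $f:U\to W$, $g:V\to X$ in $\mathcal C$, $\psi_{WX}\circ(f\otimes g)=(g\otimes f)\circ\psi_{UV}$. Conjugate braiding: for $X,Y\in\mathcal C$ let $$\xi_{XY}=\rho_{XY}\circ\overline{\psi_{YX}}\circ\rho_{YX}^{-1}:\overline X\otimes\overline Y\to\overline Y\otimes\overline X,$$ where $\overline{\psi_{YX}}:\overline{Y\otimes X}\to\overline{X\otimes Y}$ is the complex conjugate of the map $\psi_{YX}$. Then $$\overline\psi_{XY}=(\sigma_Y\otimes\sigma_X)\circ\xi_{\overline X\,\overline Y}\circ(\sigma_X^{-1}\otimes\sigma_Y^{-1}):X\otimes Y\to Y\otimes X.$$ *)

theory Defs
  imports Complex_Main "HOL-Library.FuncSet" "HOL-Algebra.Module"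
    "HOL-Algebra.Algebraic_Closure_Type"
begin

section \<open>A universe of vectors\<close>

text \<open>
  HOL has no type of all complex vector spaces. All vector spaces below have a carrier contained in
  a type \<open>'v vec\<close>, over an arbitrary type \<open>'v\<close>, which is closed under the constructions needed:
  \<open>Scal z\<close> are the elements of the one-dimensional space \<open>\<complex>\<close>, \<open>Bar v\<close> is the formal symbol
  \<open>v\<close>-bar of the complex conjugate space, and \<open>Tens [(v1,w1),...,(vn,wn)]\<close> stands for the tensor
  \<open>v1 \<otimes> w1 + ... + vn \<otimes> wn\<close>. The carrier of a general vector space is an arbitrary subset of
  \<open>'v vec\<close> with arbitrary operations, so that every complex vector space occurs up to
  isomorphism once \<open>'v\<close> is large enough.
\<close>

datatype 'v vec =
    Atom 'v
  | Scal (unscal: complex)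
  | Bar (unbar: "'v vec")
  | Tens (untens: "('v vec \<times> 'v vec) list")

abbreviation complex_field :: "complex ring"
  where "complex_field \<equiv> ring_of_type_algebra"

text \<open>
  In a \<^typ>\<open>(complex, 'v vec) module\<close> used as a plain vector space, the fields \<^const>\<open>monoid.mult\<close>
  and \<^const>\<open>monoid.one\<close> (which HOL-Algebra's module record inherits from the ring record) are
  irrelevant.
\<close>

text \<open>
  Linear maps are extensional (undefined outside the carrier of their domain), so that equality of
  functions is equality of linear maps.
\<close>

definition linear_map ::
  "(complex, 'v vec, 'm) module_scheme \<Rightarrow> (complex, 'w vec, 'n) module_scheme \<Rightarrow>
   ('v vec \<Rightarrow> 'w vec) \<Rightarrow> bool"
  where "linear_map V W f \<longleftrightarrow>
    f \<in> carrier V \<rightarrow>\<^sub>E carrier W \<and>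
    (\<forall>x\<in>carrier V. \<forall>y\<in>carrier V. f (x \<oplus>\<^bsub>V\<^esub> y) = f x \<oplus>\<^bsub>W\<^esub> f y) \<and>
    (\<forall>c. \<forall>x\<in>carrier V. f (c \<odot>\<^bsub>V\<^esub> x) = c \<odot>\<^bsub>W\<^esub> f x)"


section \<open>Tensor products of vector spaces\<close>

text \<open>
  The tensor product of \<open>V\<close> and \<open>W\<close> consists of the finite formal sums of pairs from
  \<open>carrier V \<times> carrier W\<close>, written as lists (addition is concatenation), modulo the congruence
  generated by commutativity and bilinearity. Scalars are absorbed into the first component, and
  \<open>(\<ominus>v, w)\<close> is an additive inverse of \<open>(v, w)\<close> by the rules \<open>add_left\<close> and \<open>zero\<close>.
\<close>

inductive tensor_eq ::
  "(complex, 'v vec, 'm) module_scheme \<Rightarrow> (complex, 'v vec, 'n) module_scheme \<Rightarrow>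
   ('v vec \<times> 'v vec) list \<Rightarrow> ('v vec \<times> 'v vec) list \<Rightarrow> bool"
  for V W where
  refl: "x \<in> lists (carrier V \<times> carrier W) \<Longrightarrow> tensor_eq V W x x"
| sym: "tensor_eq V W x y \<Longrightarrow> tensor_eq V W y x"
| trans: "tensor_eq V W x y \<Longrightarrow> tensor_eq V W y z \<Longrightarrow> tensor_eq V W x z"
| append: "tensor_eq V W x x' \<Longrightarrow> tensor_eq V W y y' \<Longrightarrow> tensor_eq V W (x @ y) (x' @ y')"
| comm: "x \<in> lists (carrier V \<times> carrier W) \<Longrightarrow> y \<in> lists (carrier V \<times> carrier W) \<Longrightarrow>
    tensor_eq V W (x @ y) (y @ x)"
| zero: "w \<in> carrier W \<Longrightarrow> tensor_eq V W [(\<zero>\<^bsub>V\<^esub>, w)] []"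
| add_left: "v \<in> carrier V \<Longrightarrow> v' \<in> carrier V \<Longrightarrow> w \<in> carrier W \<Longrightarrow>
    tensor_eq V W [(v \<oplus>\<^bsub>V\<^esub> v', w)] [(v, w), (v', w)]"
| add_right: "v \<in> carrier V \<Longrightarrow> w \<in> carrier W \<Longrightarrow> w' \<in> carrier W \<Longrightarrow>
    tensor_eq V W [(v, w \<oplus>\<^bsub>W\<^esub> w')] [(v, w), (v, w')]"
| scale: "v \<in> carrier V \<Longrightarrow> w \<in> carrier W \<Longrightarrow>
    tensor_eq V W [(c \<odot>\<^bsub>V\<^esub> v, w)] [(v, c \<odot>\<^bsub>W\<^esub> w)]"

text \<open>
  \<open>tens V W x\<close> is the element of the tensor product represented by the formal sum \<open>x\<close>. A
  congruence class is a set of lists and cannot itself be an element of \<^typ>\<open>'v vec\<close> (by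
  cardinality), so each class is replaced by a chosen member.
\<close>

definition tens ::
  "(complex, 'v vec, 'm) module_scheme \<Rightarrow> (complex, 'v vec, 'n) module_scheme \<Rightarrow>
   ('v vec \<times> 'v vec) list \<Rightarrow> 'v vec"
  where "tens V W x = Tens (SOME y. tensor_eq V W x y)"

definition tensor_space ::
  "(complex, 'v vec, 'm) module_scheme \<Rightarrow> (complex, 'v vec, 'n) module_scheme \<Rightarrow>
   (complex, 'v vec) module"
  where "tensor_space V W =
    \<lparr>carrier = tens V W ` lists (carrier V \<times> carrier W),
     monoid.mult = undefined, one = undefined,
     ring.zero = tens V W [],
     add = (\<lambda>s t. tens V W (untens s @ untens t)),
     module.smult = (\<lambda>c t. tens V W (map (\<lambda>(v, w). (c \<odot>\<^bsub>V\<^esub> v, w)) (untens t)))\<rparr>"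

text \<open>
  \<open>tensor_lift Z \<beta> t\<close> is the value at \<open>t\<close> of the linear map into \<open>Z\<close> induced by the bilinear map
  \<open>\<beta>\<close>, i.e. \<open>v \<otimes> w \<mapsto> \<beta> v w\<close>.
\<close>

definition tensor_lift ::
  "(complex, 'w vec, 'n) module_scheme \<Rightarrow> ('v vec \<Rightarrow> 'v vec \<Rightarrow> 'w vec) \<Rightarrow> 'v vec \<Rightarrow> 'w vec"
  where "tensor_lift Z \<beta> t = foldr (\<lambda>(v, w) s. \<beta> v w \<oplus>\<^bsub>Z\<^esub> s) (untens t) \<zero>\<^bsub>Z\<^esub>"

definition tensor_map ::
  "(complex, 'v vec, 'a) module_scheme \<Rightarrow> (complex, 'v vec, 'b) module_scheme \<Rightarrow>
   (complex, 'v vec, 'c) module_scheme \<Rightarrow> (complex, 'v vec, 'd) module_scheme \<Rightarrow>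
   ('v vec \<Rightarrow> 'v vec) \<Rightarrow> ('v vec \<Rightarrow> 'v vec) \<Rightarrow> 'v vec \<Rightarrow> 'v vec"
  where "tensor_map V W V' W' f g =
    (\<lambda>t\<in>carrier (tensor_space V W). tens V' W' (map (\<lambda>(v, w). (f v, g w)) (untens t)))"

text \<open>The associator \<open>(U \<otimes> V) \<otimes> W \<rightarrow> U \<otimes> (V \<otimes> W)\<close>.\<close>

definition assoc_map ::
  "(complex, 'v vec, 'a) module_scheme \<Rightarrow> (complex, 'v vec, 'b) module_scheme \<Rightarrow>
   (complex, 'v vec, 'c) module_scheme \<Rightarrow> 'v vec \<Rightarrow> 'v vec"
  where "assoc_map U V W =
    (\<lambda>t\<in>carrier (tensor_space (tensor_space U V) W).
      tens U (tensor_space V W)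
        [(u, tens V W [(v, w)]). (s, w) \<leftarrow> untens t, (u, v) \<leftarrow> untens s])"


section \<open>Hopf *-algebras\<close>

record 'h hopf_algebra = "(complex, 'h vec) module" +
  comult :: "'h vec \<Rightarrow> 'h vec"
  counit :: "'h vec \<Rightarrow> complex"
  antipode :: "'h vec \<Rightarrow> 'h vec"
  star :: "'h vec \<Rightarrow> 'h vec"

locale hopf_algebra = algebra: ring H + vspace: module complex_field H
  for H :: "'h hopf_algebra" (structure) +
  assumes smult_mult_left:
      "\<lbrakk>x \<in> carrier H; y \<in> carrier H\<rbrakk> \<Longrightarrow> (c \<odot> x) \<otimes> y = c \<odot> (x \<otimes> y)"
    and smult_mult_right:
      "\<lbrakk>x \<in> carrier H; y \<in> carrier H\<rbrakk> \<Longrightarrow> x \<otimes> (c \<odot> y) = c \<odot> (x \<otimes> y)"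
    and comult_linear: "linear_map H (tensor_space H H) (comult H)"
    and counit_add:
      "\<lbrakk>x \<in> carrier H; y \<in> carrier H\<rbrakk> \<Longrightarrow> counit H (x \<oplus> y) = counit H x + counit H y"
    and counit_smult: "x \<in> carrier H \<Longrightarrow> counit H (c \<odot> x) = c * counit H x"
    and coassoc:
      "x \<in> carrier H \<Longrightarrow>
        assoc_map H H H (tensor_map H H (tensor_space H H) H (comult H) id (comult H x)) =
        tensor_map H H H (tensor_space H H) id (comult H) (comult H x)"
    and counit_left: "x \<in> carrier H \<Longrightarrow> tensor_lift H (\<lambda>a b. counit H a \<odot> b) (comult H x) = x"
    and counit_right: "x \<in> carrier H \<Longrightarrow> tensor_lift H (\<lambda>a b. counit H b \<odot> a) (comult H x) = x"
    and comult_mult: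
      "\<lbrakk>x \<in> carrier H; y \<in> carrier H\<rbrakk> \<Longrightarrow>
        comult H (x \<otimes> y) =
        tens H H [(a \<otimes> c, b \<otimes> d). (a, b) \<leftarrow> untens (comult H x), (c, d) \<leftarrow> untens (comult H y)]"
    and comult_one: "comult H \<one> = tens H H [(\<one>, \<one>)]"
    and counit_mult:
      "\<lbrakk>x \<in> carrier H; y \<in> carrier H\<rbrakk> \<Longrightarrow> counit H (x \<otimes> y) = counit H x * counit H y"
    and counit_one: "counit H \<one> = 1"
    and antipode_linear: "linear_map H H (antipode H)"
    and antipode_left:
      "x \<in> carrier H \<Longrightarrow>
        tensor_lift H (\<lambda>a b. antipode H a \<otimes> b) (comult H x) = counit H x \<odot> \<one>"
    and antipode_right:
      "x \<in> carrier H \<Longrightarrow>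
        tensor_lift H (\<lambda>a b. a \<otimes> antipode H b) (comult H x) = counit H x \<odot> \<one>"

locale hopf_star_algebra = hopf_algebra +
  assumes star_closed: "x \<in> carrier H \<Longrightarrow> star H x \<in> carrier H"
    and star_add:
      "\<lbrakk>x \<in> carrier H; y \<in> carrier H\<rbrakk> \<Longrightarrow> star H (x \<oplus> y) = star H x \<oplus> star H y"
    and star_smult: "x \<in> carrier H \<Longrightarrow> star H (c \<odot> x) = cnj c \<odot> star H x"
    and star_star: "x \<in> carrier H \<Longrightarrow> star H (star H x) = x"
    and star_mult:
      "\<lbrakk>x \<in> carrier H; y \<in> carrier H\<rbrakk> \<Longrightarrow> star H (x \<otimes> y) = star H y \<otimes> star H x"
    and comult_star:
      "x \<in> carrier H \<Longrightarrow>
        comult H (star H x) = tens H H (map (\<lambda>(a, b). (star H a, star H b)) (untens (comult H x)))"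


section \<open>The category of left modules over a Hopf *-algebra\<close>

record ('h, 'v) hmod = "(complex, 'v vec) module" +
  act :: "'h vec \<Rightarrow> 'v vec \<Rightarrow> 'v vec"

locale hmodule = vspace: module complex_field V
  for H :: "'h hopf_algebra" and V :: "('h, 'v) hmod" +
  assumes act_closed: "\<lbrakk>a \<in> carrier H; v \<in> carrier V\<rbrakk> \<Longrightarrow> act V a v \<in> carrier V"
    and act_add_left:
      "\<lbrakk>a \<in> carrier H; b \<in> carrier H; v \<in> carrier V\<rbrakk> \<Longrightarrow>
        act V (a \<oplus>\<^bsub>H\<^esub> b) v = act V a v \<oplus>\<^bsub>V\<^esub> act V b v"
    and act_add_right:
      "\<lbrakk>a \<in> carrier H; v \<in> carrier V; w \<in> carrier V\<rbrakk> \<Longrightarrow>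
        act V a (v \<oplus>\<^bsub>V\<^esub> w) = act V a v \<oplus>\<^bsub>V\<^esub> act V a w"
    and act_smult_left:
      "\<lbrakk>a \<in> carrier H; v \<in> carrier V\<rbrakk> \<Longrightarrow> act V (c \<odot>\<^bsub>H\<^esub> a) v = c \<odot>\<^bsub>V\<^esub> act V a v"
    and act_smult_right:
      "\<lbrakk>a \<in> carrier H; v \<in> carrier V\<rbrakk> \<Longrightarrow> act V a (c \<odot>\<^bsub>V\<^esub> v) = c \<odot>\<^bsub>V\<^esub> act V a v"
    and act_mult:
      "\<lbrakk>a \<in> carrier H; b \<in> carrier H; v \<in> carrier V\<rbrakk> \<Longrightarrow>
        act V (a \<otimes>\<^bsub>H\<^esub> b) v = act V a (act V b v)"
    and act_one: "v \<in> carrier V \<Longrightarrow> act V \<one>\<^bsub>H\<^esub> v = v"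

record ('h, 'v) arrow =
  source :: "('h, 'v) hmod"
  target :: "('h, 'v) hmod"
  fn :: "'v vec \<Rightarrow> 'v vec"

definition hmod_arrow :: "'h hopf_algebra \<Rightarrow> ('h, 'v) arrow \<Rightarrow> bool"
  where "hmod_arrow H f \<longleftrightarrow>
    hmodule H (source f) \<and> hmodule H (target f) \<and>
    linear_map (source f) (target f) (fn f) \<and>
    (\<forall>a\<in>carrier H. \<forall>v\<in>carrier (source f). fn f (act (source f) a v) = act (target f) a (fn f v))"

definition id_arrow :: "('h, 'v) hmod \<Rightarrow> ('h, 'v) arrow"
  where "id_arrow V = \<lparr>source = V, target = V, fn = (\<lambda>v\<in>carrier V. v)\<rparr>"

definition comp_arrow :: "('h, 'v) arrow \<Rightarrow> ('h, 'v) arrow \<Rightarrow> ('h, 'v) arrow"  (infixr \<open>\<bullet>\<close> 55)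
  where "g \<bullet> f =
    \<lparr>source = source f, target = target g, fn = compose (carrier (source f)) (fn g) (fn f)\<rparr>"

text \<open>Only meaningful for bijective arrows.\<close>

definition inv_arrow :: "('h, 'v) arrow \<Rightarrow> ('h, 'v) arrow"
  where "inv_arrow f =
    \<lparr>source = target f, target = source f,
     fn = (\<lambda>w\<in>carrier (target f). inv_into (carrier (source f)) (fn f) w)\<rparr>"


subsection \<open>Monoidal structure\<close>

definition unit_hmod :: "'h hopf_algebra \<Rightarrow> ('h, 'v) hmod"
  where "unit_hmod H =
    \<lparr>carrier = range Scal,
     monoid.mult = undefined, one = undefined,
     ring.zero = Scal 0,
     add = (\<lambda>x y. Scal (unscal x + unscal y)),
     module.smult = (\<lambda>c x. Scal (c * unscal x)),
     act = (\<lambda>a x. Scal (counit H a * unscal x))\<rparr>"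

definition tensor_hmod ::
  "('h, 'v) hmod \<Rightarrow> 'h hopf_algebra \<Rightarrow> ('h, 'v) hmod \<Rightarrow> ('h, 'v) hmod"
  (\<open>(_ \<boxtimes>\<^bsub>_\<^esub> _)\<close> [71, 0, 71] 70)
  where "V \<boxtimes>\<^bsub>H\<^esub> W =
    module.extend (tensor_space V W)
      (hmod.fields (\<lambda>a t.
        tens V W [(act V b v, act W c w). (b, c) \<leftarrow> untens (comult H a), (v, w) \<leftarrow> untens t]))"

definition tensor_arrow ::
  "('h, 'v) arrow \<Rightarrow> 'h hopf_algebra \<Rightarrow> ('h, 'v) arrow \<Rightarrow> ('h, 'v) arrow"
  (\<open>(_ \<star>\<^bsub>_\<^esub> _)\<close> [71, 0, 71] 70)
  where "f \<star>\<^bsub>H\<^esub> g =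
    \<lparr>source = source f \<boxtimes>\<^bsub>H\<^esub> source g, target = target f \<boxtimes>\<^bsub>H\<^esub> target g,
     fn = tensor_map (source f) (source g) (target f) (target g) (fn f) (fn g)\<rparr>"

definition assoc_arrow ::
  "'h hopf_algebra \<Rightarrow> ('h, 'v) hmod \<Rightarrow> ('h, 'v) hmod \<Rightarrow> ('h, 'v) hmod \<Rightarrow> ('h, 'v) arrow"
  where "assoc_arrow H U V W =
    \<lparr>source = (U \<boxtimes>\<^bsub>H\<^esub> V) \<boxtimes>\<^bsub>H\<^esub> W, target = U \<boxtimes>\<^bsub>H\<^esub> (V \<boxtimes>\<^bsub>H\<^esub> W), fn = assoc_map U V W\<rparr>"


subsection \<open>Complex conjugation\<close>

definition conj_hmod :: "'h hopf_algebra \<Rightarrow> ('h, 'v) hmod \<Rightarrow> ('h, 'v) hmod"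
  where "conj_hmod H V =
    \<lparr>carrier = Bar ` carrier V,
     monoid.mult = undefined, one = undefined,
     ring.zero = Bar \<zero>\<^bsub>V\<^esub>,
     add = (\<lambda>x y. Bar (unbar x \<oplus>\<^bsub>V\<^esub> unbar y)),
     module.smult = (\<lambda>c x. Bar (cnj c \<odot>\<^bsub>V\<^esub> unbar x)),
     act = (\<lambda>a x. Bar (act V (star H (antipode H a)) (unbar x)))\<rparr>"

definition conj_arrow :: "'h hopf_algebra \<Rightarrow> ('h, 'v) arrow \<Rightarrow> ('h, 'v) arrow"
  where "conj_arrow H f =
    \<lparr>source = conj_hmod H (source f), target = conj_hmod H (target f),
     fn = (\<lambda>x\<in>carrier (conj_hmod H (source f)). Bar (fn f (unbar x)))\<rparr>"

definition rho_arrow ::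
  "'h hopf_algebra \<Rightarrow> ('h, 'v) hmod \<Rightarrow> ('h, 'v) hmod \<Rightarrow> ('h, 'v) arrow"
  where "rho_arrow H V W =
    \<lparr>source = conj_hmod H (V \<boxtimes>\<^bsub>H\<^esub> W), target = conj_hmod H W \<boxtimes>\<^bsub>H\<^esub> conj_hmod H V,
     fn = (\<lambda>x\<in>carrier (conj_hmod H (V \<boxtimes>\<^bsub>H\<^esub> W)).
       tens (conj_hmod H W) (conj_hmod H V) (map (\<lambda>(v, w). (Bar w, Bar v)) (untens (unbar x))))\<rparr>"

definition sigma_arrow :: "'h hopf_algebra \<Rightarrow> ('h, 'v) hmod \<Rightarrow> ('h, 'v) arrow"
  where "sigma_arrow H V =
    \<lparr>source = conj_hmod H (conj_hmod H V), target = V,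
     fn = (\<lambda>x\<in>carrier (conj_hmod H (conj_hmod H V)). unbar (unbar x))\<rparr>"


section \<open>Sub-monoidal categories and braidings\<close>

record ('h, 'v) subcategory =
  Obj :: "('h, 'v) hmod set"
  Mor :: "('h, 'v) arrow set"

definition subcategory_hmod :: "'h hopf_algebra \<Rightarrow> ('h, 'v) subcategory \<Rightarrow> bool"
  where "subcategory_hmod H C \<longleftrightarrow>
    (\<forall>V\<in>Obj C. hmodule H V) \<and>
    (\<forall>f\<in>Mor C. hmod_arrow H f \<and> source f \<in> Obj C \<and> target f \<in> Obj C) \<and>
    (\<forall>V\<in>Obj C. id_arrow V \<in> Mor C) \<and>
    (\<forall>f\<in>Mor C. \<forall>g\<in>Mor C. source g = target f \<longrightarrow> g \<bullet> f \<in> Mor C)"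

text \<open>
  \<open>\<complex>\<close> and tensor products are the specific modules constructed above. The associators are not
  required to be morphisms of the subcategory (nor are the unit constraints).
\<close>

definition sub_monoidal_category :: "'h hopf_algebra \<Rightarrow> ('h, 'v) subcategory \<Rightarrow> bool"
  where "sub_monoidal_category H C \<longleftrightarrow>
    subcategory_hmod H C \<and>
    unit_hmod H \<in> Obj C \<and>
    (\<forall>V\<in>Obj C. \<forall>W\<in>Obj C. V \<boxtimes>\<^bsub>H\<^esub> W \<in> Obj C) \<and>
    (\<forall>f\<in>Mor C. \<forall>g\<in>Mor C. f \<star>\<^bsub>H\<^esub> g \<in> Mor C)"

definition iso_in :: "('h, 'v) subcategory \<Rightarrow> ('h, 'v) arrow \<Rightarrow> bool"
  where "iso_in C f \<longleftrightarrow> f \<in> Mor C \<and>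
    (\<exists>g\<in>Mor C. source g = target f \<and> target g = source f \<and>
      g \<bullet> f = id_arrow (source f) \<and> f \<bullet> g = id_arrow (target f))"

text \<open>
  In the two hexagon identities the associators, suppressed in the usual notation, are inserted;
  the identities are equalities of linear maps.
\<close>

definition braiding ::
  "'h hopf_algebra \<Rightarrow> ('h, 'v) subcategory \<Rightarrow>
   (('h, 'v) hmod \<Rightarrow> ('h, 'v) hmod \<Rightarrow> ('h, 'v) arrow) \<Rightarrow> bool"
  where "braiding H C \<psi> \<longleftrightarrow>
    (\<forall>V\<in>Obj C. \<forall>W\<in>Obj C.
      source (\<psi> V W) = V \<boxtimes>\<^bsub>H\<^esub> W \<and> target (\<psi> V W) = W \<boxtimes>\<^bsub>H\<^esub> V \<and> iso_in C (\<psi> V W)) \<and>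
    (\<forall>U\<in>Obj C. \<forall>V\<in>Obj C. \<forall>W\<in>Obj C.
      \<psi> U (V \<boxtimes>\<^bsub>H\<^esub> W) =
        inv_arrow (assoc_arrow H V W U) \<bullet> (id_arrow V \<star>\<^bsub>H\<^esub> \<psi> U W) \<bullet>
        assoc_arrow H V U W \<bullet> (\<psi> U V \<star>\<^bsub>H\<^esub> id_arrow W) \<bullet> inv_arrow (assoc_arrow H U V W)) \<and>
    (\<forall>U\<in>Obj C. \<forall>V\<in>Obj C. \<forall>W\<in>Obj C.
      \<psi> (U \<boxtimes>\<^bsub>H\<^esub> V) W =
        assoc_arrow H W U V \<bullet> (\<psi> U W \<star>\<^bsub>H\<^esub> id_arrow V) \<bullet>
        inv_arrow (assoc_arrow H U W V) \<bullet> (id_arrow U \<star>\<^bsub>H\<^esub> \<psi> V W) \<bullet> assoc_arrow H U V W) \<and>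
    (\<forall>f\<in>Mor C. \<forall>g\<in>Mor C.
      \<psi> (target f) (target g) \<bullet> (f \<star>\<^bsub>H\<^esub> g) = (g \<star>\<^bsub>H\<^esub> f) \<bullet> \<psi> (source f) (source g))"

definition xi_arrow ::
  "'h hopf_algebra \<Rightarrow> (('h, 'v) hmod \<Rightarrow> ('h, 'v) hmod \<Rightarrow> ('h, 'v) arrow) \<Rightarrow>
   ('h, 'v) hmod \<Rightarrow> ('h, 'v) hmod \<Rightarrow> ('h, 'v) arrow"
  where "xi_arrow H \<psi> V W =
    rho_arrow H V W \<bullet> conj_arrow H (\<psi> W V) \<bullet> inv_arrow (rho_arrow H W V)"

definition conjugate_braiding ::
  "'h hopf_algebra \<Rightarrow> (('h, 'v) hmod \<Rightarrow> ('h, 'v) hmod \<Rightarrow> ('h, 'v) arrow) \<Rightarrow>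
   ('h, 'v) hmod \<Rightarrow> ('h, 'v) hmod \<Rightarrow> ('h, 'v) arrow"
  where "conjugate_braiding H \<psi> V W =
    (sigma_arrow H W \<star>\<^bsub>H\<^esub> sigma_arrow H V) \<bullet>
    xi_arrow H \<psi> (conj_hmod H V) (conj_hmod H W) \<bullet>
    (inv_arrow (sigma_arrow H V) \<star>\<^bsub>H\<^esub> inv_arrow (sigma_arrow H W))"

end

theory Submission
  imports Defs
begin

text \<open>
  Write \<open>\<tau>\<close> for the antilinear bijection \<open>V \<otimes> W \<rightarrow> W\<^sup>- \<otimes> V\<^sup>-\<close>, \<open>v \<otimes> w \<mapsto> w\<^sup>- \<otimes> v\<^sup>-\<close>
  (a superscript minus denotes the complex conjugate), that is, \<open>\<rho>\<close> precomposed with the bar.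
  Unfolding the definition of the conjugate braiding \<open>\<phi>\<close> on elements, and using
  that \<open>\<sigma> \<otimes> \<sigma>\<close> undoes \<open>\<tau>\<close> applied twice (\<open>sigma_tau_tau\<close>, \<open>tau_sigma_tau\<close>), one finds the
  identity that carries the proof (\<open>tau_phi\<close>):
  \<open>\<tau> \<circ> \<phi> V W = \<psi> W\<^sup>- V\<^sup>- \<circ> \<tau>\<close>.
  So \<open>\<phi>\<close> is \<open>\<psi>\<close> seen through \<open>\<tau>\<close>. As \<open>\<tau>\<close> is injective and natural, naturality of \<open>\<phi>\<close> is
  naturality of \<open>\<psi>\<close>. Each \<open>\<phi>\<close> is an isomorphism of the category because it is composed of
  tensor products and conjugates of such isomorphisms.

  For the hexagons, \<open>\<tau>\<close> is applied twice to a triple tensor product, giving the order-reversing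
  maps
  \<open>L : (U \<otimes> V) \<otimes> W \<rightarrow> W\<^sup>- \<otimes> (V\<^sup>- \<otimes> U\<^sup>-)\<close> and
  \<open>R : U \<otimes> (V \<otimes> W) \<rightarrow> (W\<^sup>- \<otimes> V\<^sup>-) \<otimes> U\<^sup>-\<close>.
  They are intertwined by the associators: \<open>\<alpha> \<circ> R \<circ> \<alpha> = L\<close> (\<open>assoc_R_assoc\<close>). Under \<open>L\<close> and
  \<open>R\<close> the maps \<open>\<phi> \<otimes> id\<close> and \<open>id \<otimes> \<phi>\<close> become \<open>id \<otimes> \<psi>\<close> and \<open>\<psi> \<otimes> id\<close> (\<open>L_phi\<close>, \<open>R_phi\<close>), and
  \<open>\<phi>\<close> on a tensor product becomes \<open>\<psi>\<close> on a tensor product in the other order, by naturality of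
  \<open>\<psi>\<close> with respect to \<open>\<rho>\<close>. Because of this reversal, each hexagon for \<open>\<phi>\<close> is the image of the
  other hexagon for \<open>\<psi>\<close>.

  The intertwining identity also shows that \<open>\<alpha>\<close> is injective, since \<open>L\<close> is; hence no
  inverse of the associator has to be constructed.
\<close>

section \<open>Representatives of tensors\<close>

lemma complex_field_simps [simp]:
  "carrier complex_field = UNIV" "\<zero>\<^bsub>complex_field\<^esub> = 0" "\<one>\<^bsub>complex_field\<^esub> = 1"
  "x \<oplus>\<^bsub>complex_field\<^esub> y = x + y" "x \<otimes>\<^bsub>complex_field\<^esub> y = x * y"
  by (simp_all add: ring_of_type_algebra_def)

abbreviation complex_space :: "(complex, 'v vec, 'm) module_scheme \<Rightarrow> bool"
  where "complex_space \<equiv> module complex_field"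

lemma complex_space_simps:
  assumes "complex_space V"
  shows "\<zero>\<^bsub>V\<^esub> \<in> carrier V"
    and "\<lbrakk>x \<in> carrier V; y \<in> carrier V\<rbrakk> \<Longrightarrow> x \<oplus>\<^bsub>V\<^esub> y \<in> carrier V"
    and "x \<in> carrier V \<Longrightarrow> c \<odot>\<^bsub>V\<^esub> x \<in> carrier V"
    and "x \<in> carrier V \<Longrightarrow> 0 \<odot>\<^bsub>V\<^esub> x = \<zero>\<^bsub>V\<^esub>"
    and "c \<odot>\<^bsub>V\<^esub> \<zero>\<^bsub>V\<^esub> = \<zero>\<^bsub>V\<^esub>"
    and "\<lbrakk>x \<in> carrier V; y \<in> carrier V\<rbrakk> \<Longrightarrow> c \<odot>\<^bsub>V\<^esub> (x \<oplus>\<^bsub>V\<^esub> y) = c \<odot>\<^bsub>V\<^esub> x \<oplus>\<^bsub>V\<^esub> c \<odot>\<^bsub>V\<^esub> y"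
    and "x \<in> carrier V \<Longrightarrow> c \<odot>\<^bsub>V\<^esub> (d \<odot>\<^bsub>V\<^esub> x) = (c * d) \<odot>\<^bsub>V\<^esub> x"
proof -
  interpret module complex_field V by fact
  show "\<zero>\<^bsub>V\<^esub> \<in> carrier V"
    and "\<lbrakk>x \<in> carrier V; y \<in> carrier V\<rbrakk> \<Longrightarrow> x \<oplus>\<^bsub>V\<^esub> y \<in> carrier V"
    and "x \<in> carrier V \<Longrightarrow> c \<odot>\<^bsub>V\<^esub> x \<in> carrier V"
    by auto
  show "x \<in> carrier V \<Longrightarrow> 0 \<odot>\<^bsub>V\<^esub> x = \<zero>\<^bsub>V\<^esub>"
    using smult_l_null by simp
  show "c \<odot>\<^bsub>V\<^esub> \<zero>\<^bsub>V\<^esub> = \<zero>\<^bsub>V\<^esub>"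
    using smult_r_null by simp
  show "\<lbrakk>x \<in> carrier V; y \<in> carrier V\<rbrakk> \<Longrightarrow> c \<odot>\<^bsub>V\<^esub> (x \<oplus>\<^bsub>V\<^esub> y) = c \<odot>\<^bsub>V\<^esub> x \<oplus>\<^bsub>V\<^esub> c \<odot>\<^bsub>V\<^esub> y"
    using smult_r_distr by simp
  show "x \<in> carrier V \<Longrightarrow> c \<odot>\<^bsub>V\<^esub> (d \<odot>\<^bsub>V\<^esub> x) = (c * d) \<odot>\<^bsub>V\<^esub> x"
    using smult_assoc1[of c d x] by simp
qed

lemma linear_map_zero:
  assumes "complex_space V" "complex_space W" "linear_map V W f"
  shows "f \<zero>\<^bsub>V\<^esub> = \<zero>\<^bsub>W\<^esub>"
proof -
  have z: "\<zero>\<^bsub>V\<^esub> \<in> carrier V" and fz: "f \<zero>\<^bsub>V\<^esub> \<in> carrier W"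
    using assms complex_space_simps(1)[OF assms(1)] by (auto simp: linear_map_def)
  have "f (0 \<odot>\<^bsub>V\<^esub> \<zero>\<^bsub>V\<^esub>) = 0 \<odot>\<^bsub>W\<^esub> f \<zero>\<^bsub>V\<^esub>"
    using assms(3) z by (simp add: linear_map_def)
  thus ?thesis
    using z fz by (simp add: complex_space_simps(4)[OF assms(1)] complex_space_simps(4)[OF assms(2)])
qed

lemma tensor_eq_lists:
  assumes "complex_space V" "complex_space W" "tensor_eq V W x y"
  shows "x \<in> lists (carrier V \<times> carrier W) \<and> y \<in> lists (carrier V \<times> carrier W)"
  using assms(3)
  by induction
    (auto simp: complex_space_simps[OF assms(1)] complex_space_simps[OF assms(2)])

lemma tensor_eq_untens_tens:
  assumes "x \<in> lists (carrier V \<times> carrier W)"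
  shows "tensor_eq V W x (untens (tens V W x))"
  unfolding tens_def vec.sel
  by (rule someI[where P = "tensor_eq V W x"]) (rule tensor_eq.refl[OF assms])

lemma tens_eqI:
  assumes "tensor_eq V W x y"
  shows "tens V W x = tens V W y"
proof -
  have "tensor_eq V W x = tensor_eq V W y"
    using assms by (blast intro: tensor_eq.sym tensor_eq.trans)
  thus ?thesis by (simp add: tens_def)
qed

text \<open>
  The generating relations only say that the zero of the left factor gives the zero tensor; for the
  right factor, move the scalar \<open>0\<close> across.
\<close>

lemma tensor_eq_zero_right:
  assumes "complex_space V" "complex_space W" "v \<in> carrier V"
  shows "tensor_eq V W [(v, \<zero>\<^bsub>W\<^esub>)] []"
proof -
  note V = complex_space_simps[OF assms(1)] and W = complex_space_simps[OF assms(2)]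
  have "tensor_eq V W [(0 \<odot>\<^bsub>V\<^esub> v, \<zero>\<^bsub>W\<^esub>)] [(v, 0 \<odot>\<^bsub>W\<^esub> \<zero>\<^bsub>W\<^esub>)]"
    by (rule tensor_eq.scale) (use assms W in auto)
  hence "tensor_eq V W [(v, \<zero>\<^bsub>W\<^esub>)] [(\<zero>\<^bsub>V\<^esub>, \<zero>\<^bsub>W\<^esub>)]"
    using assms V W by (simp add: tensor_eq.sym)
  thus ?thesis
    by (rule tensor_eq.trans) (rule tensor_eq.zero, rule W)
qed

text \<open>
  The universal property of the tensor product, for maps given on formal sums by a list
  homomorphism \<open>\<Phi>\<close>: it suffices to check the defining relations on single pairs. The target is
  again a set of formal sums, as this is the form of the maps between tensor products below.
\<close>

lemma tensor_eq_bilinear: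
  assumes app: "\<And>x y. \<Phi> (x @ y) = \<Phi> x @ \<Phi> y"
    and closed: "\<And>v w. \<lbrakk>v \<in> carrier V; w \<in> carrier W\<rbrakk> \<Longrightarrow>
      \<Phi> [(v, w)] \<in> lists (carrier V' \<times> carrier W')"
    and zero: "\<And>w. w \<in> carrier W \<Longrightarrow> tensor_eq V' W' (\<Phi> [(\<zero>\<^bsub>V\<^esub>, w)]) []"
    and add_left: "\<And>v v' w. \<lbrakk>v \<in> carrier V; v' \<in> carrier V; w \<in> carrier W\<rbrakk> \<Longrightarrow>
      tensor_eq V' W' (\<Phi> [(v \<oplus>\<^bsub>V\<^esub> v', w)]) (\<Phi> [(v, w), (v', w)])"
    and add_right: "\<And>v w w'. \<lbrakk>v \<in> carrier V; w \<in> carrier W; w' \<in> carrier W\<rbrakk> \<Longrightarrow>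
      tensor_eq V' W' (\<Phi> [(v, w \<oplus>\<^bsub>W\<^esub> w')]) (\<Phi> [(v, w), (v, w')])"
    and scale: "\<And>c v w. \<lbrakk>v \<in> carrier V; w \<in> carrier W\<rbrakk> \<Longrightarrow>
      tensor_eq V' W' (\<Phi> [(c \<odot>\<^bsub>V\<^esub> v, w)]) (\<Phi> [(v, c \<odot>\<^bsub>W\<^esub> w)])"
    and "tensor_eq V W x y"
  shows "tensor_eq V' W' (\<Phi> x) (\<Phi> y)"
proof -
  have nil: "\<Phi> [] = []"
    using app[of "[]" "[]"] by simp
  have lists: "\<Phi> x \<in> lists (carrier V' \<times> carrier W')"
    if "x \<in> lists (carrier V \<times> carrier W)" for x
    using that
  proof (induction x)
    case (Cons a x)
    obtain v w where "a = (v, w)" by (cases a)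
    with Cons closed[of v w] app[of "[a]" x] show ?case by auto
  qed (simp add: nil)
  show ?thesis
    using \<open>tensor_eq V W x y\<close>
  proof (induction rule: tensor_eq.induct)
    case (append x x' y y')
    thus ?case by (simp add: app tensor_eq.append)
  next
    case (comm x y)
    thus ?case by (simp only: app tensor_eq.comm lists)
  next
    case (refl x)
    thus ?case by (intro tensor_eq.refl lists)
  qed (auto simp: nil zero add_left add_right scale intro: tensor_eq.sym tensor_eq.trans)
qed

lemma tensor_hmod_simps:
  "carrier (V \<boxtimes>\<^bsub>H\<^esub> W) = tens V W ` lists (carrier V \<times> carrier W)"
  "\<zero>\<^bsub>V \<boxtimes>\<^bsub>H\<^esub> W\<^esub> = tens V W []"
  "s \<oplus>\<^bsub>V \<boxtimes>\<^bsub>H\<^esub> W\<^esub> t = tens V W (untens s @ untens t)"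
  "c \<odot>\<^bsub>V \<boxtimes>\<^bsub>H\<^esub> W\<^esub> t = tens V W (map (\<lambda>(v, w). (c \<odot>\<^bsub>V\<^esub> v, w)) (untens t))"
  by (simp_all add: tensor_hmod_def tensor_space_def module.defs)

lemma tens_closed [simp, intro]:
  "x \<in> lists (carrier V \<times> carrier W) \<Longrightarrow> tens V W x \<in> carrier (V \<boxtimes>\<^bsub>H\<^esub> W)"
  by (simp add: tensor_hmod_simps)

lemma tensor_add:
  assumes "x \<in> lists (carrier V \<times> carrier W)" "y \<in> lists (carrier V \<times> carrier W)"
  shows "tens V W x \<oplus>\<^bsub>V \<boxtimes>\<^bsub>H\<^esub> W\<^esub> tens V W y = tens V W (x @ y)"
  unfolding tensor_hmod_simps
  by (rule tens_eqI) (intro tensor_eq.append tensor_eq.sym[OF tensor_eq_untens_tens] assms)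

lemma tensor_smult_left:
  assumes "complex_space V" "x \<in> lists (carrier V \<times> carrier W)"
  shows "c \<odot>\<^bsub>V \<boxtimes>\<^bsub>H\<^esub> W\<^esub> tens V W x = tens V W (map (\<lambda>(v, w). (c \<odot>\<^bsub>V\<^esub> v, w)) x)"
proof -
  note V = complex_space_simps[OF assms(1)]
  let ?\<Phi> = "map (\<lambda>(v, w). (c \<odot>\<^bsub>V\<^esub> v, w))"
  have "tensor_eq V W (?\<Phi> (untens (tens V W x))) (?\<Phi> x)"
  proof (rule tensor_eq_bilinear[where V = V and W = W and \<Phi> = "?\<Phi>"])
    fix d v w assume v: "v \<in> carrier V" and w: "w \<in> carrier W"
    have "c \<odot>\<^bsub>V\<^esub> (d \<odot>\<^bsub>V\<^esub> v) = d \<odot>\<^bsub>V\<^esub> (c \<odot>\<^bsub>V\<^esub> v)"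
      using v by (simp add: V mult.commute)
    thus "tensor_eq V W (?\<Phi> [(d \<odot>\<^bsub>V\<^esub> v, w)]) (?\<Phi> [(v, d \<odot>\<^bsub>W\<^esub> w)])"
      using v w by (simp add: V tensor_eq.scale del: V(7))
  qed (use assms in \<open>auto simp: V intro!: tensor_eq.intros(6,7,8)
         intro: tensor_eq.sym[OF tensor_eq_untens_tens]\<close>)
  thus ?thesis
    unfolding tensor_hmod_simps by (rule tens_eqI)
qed

lemma tensor_smult_right:
  assumes "complex_space V" "v \<in> carrier V" "w \<in> carrier W"
  shows "c \<odot>\<^bsub>V \<boxtimes>\<^bsub>H\<^esub> W\<^esub> tens V W [(v, w)] = tens V W [(v, c \<odot>\<^bsub>W\<^esub> w)]"
  using tensor_smult_left[of V "[(v, w)]" W H c] assms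
  by (simp add: tens_eqI[OF tensor_eq.scale])

lemma tensor_map_tens:
  assumes "complex_space V" "complex_space V'"
    and f: "linear_map V V' f" and g: "linear_map W W' g"
    and x: "x \<in> lists (carrier V \<times> carrier W)"
  shows "tensor_map V W V' W' f g (tens V W x) = tens V' W' (map (\<lambda>(v, w). (f v, g w)) x)"
    and "map (\<lambda>(v, w). (f v, g w)) x \<in> lists (carrier V' \<times> carrier W')"
proof -
  let ?\<Phi> = "map (\<lambda>(v, w). (f v, g w))"
  note f' = f[unfolded linear_map_def] and g' = g[unfolded linear_map_def]
  show "?\<Phi> x \<in> lists (carrier V' \<times> carrier W')"
    using x f' g' by (auto simp: in_lists_conv_set)
  have "tensor_eq V' W' (?\<Phi> (untens (tens V W x))) (?\<Phi> x)"
    by (rule tensor_eq_bilinear[where V = V and W = W and \<Phi> = "?\<Phi>"])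
      (use x f' g' linear_map_zero[OF assms(1,2) f] in
        \<open>auto intro!: tensor_eq.intros(6,7,8,9) intro: tensor_eq.sym[OF tensor_eq_untens_tens]\<close>)
  moreover have "tens V W x \<in> carrier (tensor_space V W)"
    using x by (simp add: tensor_space_def)
  ultimately show "tensor_map V W V' W' f g (tens V W x) = tens V' W' (?\<Phi> x)"
    by (simp add: tensor_map_def tens_eqI)
qed

lemma conj_hmod_simps:
  "carrier (conj_hmod H V) = Bar ` carrier V"
  "\<zero>\<^bsub>conj_hmod H V\<^esub> = Bar \<zero>\<^bsub>V\<^esub>"
  "x \<oplus>\<^bsub>conj_hmod H V\<^esub> y = Bar (unbar x \<oplus>\<^bsub>V\<^esub> unbar y)"
  "c \<odot>\<^bsub>conj_hmod H V\<^esub> x = Bar (cnj c \<odot>\<^bsub>V\<^esub> unbar x)"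
  by (simp_all add: conj_hmod_def)

abbreviation flip_bar :: "('v vec \<times> 'v vec) list \<Rightarrow> ('v vec \<times> 'v vec) list"
  where "flip_bar \<equiv> map (\<lambda>(v, w). (Bar w, Bar v))"

text \<open>
  The maps \<open>tensor_map\<close>, \<open>\<rho>\<close> and the associator are defined through the representative chosen by
  \<open>untens\<close>. This lemma, its analogue for \<open>tensor_map\<close> and \<open>assoc_triples\<close> below allow them to be
  computed on any representative. Scalars move in the opposite direction here, since the two
  factors are exchanged.
\<close>

lemma rho_tens:
  assumes V': "complex_space (conj_hmod H V)" and W': "complex_space (conj_hmod H W)"
    and x: "x \<in> lists (carrier V \<times> carrier W)"
  shows "fn (rho_arrow H V W) (Bar (tens V W x)) =
      tens (conj_hmod H W) (conj_hmod H V) (flip_bar x)"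
    and "flip_bar x \<in> lists (carrier (conj_hmod H W) \<times> carrier (conj_hmod H V))"
proof -
  show "flip_bar x \<in> lists (carrier (conj_hmod H W) \<times> carrier (conj_hmod H V))"
    using x by (auto simp: in_lists_conv_set conj_hmod_simps)
  have "tensor_eq (conj_hmod H W) (conj_hmod H V) (flip_bar (untens (tens V W x))) (flip_bar x)"
  proof (rule tensor_eq_bilinear[where V = V and W = W and \<Phi> = flip_bar])
    fix w assume "w \<in> carrier W"
    thus "tensor_eq (conj_hmod H W) (conj_hmod H V) (flip_bar [(\<zero>\<^bsub>V\<^esub>, w)]) []"
      using tensor_eq_zero_right[OF W' V', of "Bar w"] by (simp add: conj_hmod_simps)
  next
    fix v v' w assume "v \<in> carrier V" "v' \<in> carrier V" "w \<in> carrier W"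
    thus "tensor_eq (conj_hmod H W) (conj_hmod H V)
        (flip_bar [(v \<oplus>\<^bsub>V\<^esub> v', w)]) (flip_bar [(v, w), (v', w)])"
      using tensor_eq.add_right[of "Bar w" "conj_hmod H W" "Bar v" "conj_hmod H V" "Bar v'"]
      by (simp add: conj_hmod_simps)
  next
    fix v w w' assume "v \<in> carrier V" "w \<in> carrier W" "w' \<in> carrier W"
    thus "tensor_eq (conj_hmod H W) (conj_hmod H V)
        (flip_bar [(v, w \<oplus>\<^bsub>W\<^esub> w')]) (flip_bar [(v, w), (v, w')])"
      using tensor_eq.add_left[of "Bar w" "conj_hmod H W" "Bar w'" "Bar v" "conj_hmod H V"]
      by (simp add: conj_hmod_simps)
  next
    fix c v w assume "v \<in> carrier V" "w \<in> carrier W"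
    thus "tensor_eq (conj_hmod H W) (conj_hmod H V)
        (flip_bar [(c \<odot>\<^bsub>V\<^esub> v, w)]) (flip_bar [(v, c \<odot>\<^bsub>W\<^esub> w)])"
      using tensor_eq.scale[of "Bar w" "conj_hmod H W" "Bar v" "conj_hmod H V" "cnj c"]
      by (simp add: conj_hmod_simps tensor_eq.sym)
  qed (use x in \<open>auto simp: conj_hmod_simps intro: tensor_eq.sym[OF tensor_eq_untens_tens]\<close>)
  thus "fn (rho_arrow H V W) (Bar (tens V W x)) =
      tens (conj_hmod H W) (conj_hmod H V) (flip_bar x)"
    using x by (simp add: rho_arrow_def conj_hmod_simps tensor_hmod_simps tens_eqI)
qed

lemma tensor_eq_cong:
  assumes "carrier V = carrier V'" "carrier W = carrier W'" "\<zero>\<^bsub>V\<^esub> = \<zero>\<^bsub>V'\<^esub>"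
    "(\<oplus>\<^bsub>V\<^esub>) = (\<oplus>\<^bsub>V'\<^esub>)" "(\<oplus>\<^bsub>W\<^esub>) = (\<oplus>\<^bsub>W'\<^esub>)"
    "(\<odot>\<^bsub>V\<^esub>) = (\<odot>\<^bsub>V'\<^esub>)" "(\<odot>\<^bsub>W\<^esub>) = (\<odot>\<^bsub>W'\<^esub>)"
    and "tensor_eq V W x y"
  shows "tensor_eq V' W' x y"
  using assms(8)
  by induction (auto simp: assms(1-7) intro: tensor_eq.intros)

text \<open>
  The associator is defined on the underlying vector spaces, whereas the objects of the category
  are modules. The choice of a representative depends only on the vector space operations, so the
  two views give the same elements.
\<close>

lemma tens_tensor_space:
  fixes U V W :: "('b, 'a) hmod"
  shows
  "tens (tensor_space U V) W = tens (U \<boxtimes>\<^bsub>H\<^esub> V) W"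
  "tens U (tensor_space V W) = tens U (V \<boxtimes>\<^bsub>H\<^esub> W)"
proof -
  have eq: "carrier (V \<boxtimes>\<^bsub>H\<^esub> W) = carrier (tensor_space V W)"
    "\<zero>\<^bsub>V \<boxtimes>\<^bsub>H\<^esub> W\<^esub> = \<zero>\<^bsub>tensor_space V W\<^esub>"
    "(\<oplus>\<^bsub>V \<boxtimes>\<^bsub>H\<^esub> W\<^esub>) = (\<oplus>\<^bsub>tensor_space V W\<^esub>)"
    "(\<odot>\<^bsub>V \<boxtimes>\<^bsub>H\<^esub> W\<^esub>) = (\<odot>\<^bsub>tensor_space V W\<^esub>)"
    for V W :: "('b, 'a) hmod"
    by (simp_all add: tensor_hmod_def tensor_space_def module.defs)
  have "tensor_eq (tensor_space U V) W = tensor_eq (U \<boxtimes>\<^bsub>H\<^esub> V) W"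
    by (intro ext iffI; erule tensor_eq_cong[rotated -1]) (simp_all add: eq)
  thus "tens (tensor_space U V) W = tens (U \<boxtimes>\<^bsub>H\<^esub> V) W"
    by (simp add: tens_def fun_eq_iff)
  have "tensor_eq U (tensor_space V W) = tensor_eq U (V \<boxtimes>\<^bsub>H\<^esub> W)"
    by (intro ext iffI; erule tensor_eq_cong[rotated -1]) (simp_all add: eq)
  thus "tens U (tensor_space V W) = tens U (V \<boxtimes>\<^bsub>H\<^esub> W)"
    by (simp add: tens_def fun_eq_iff)
qed

lemma carrier_tensor_space_left:
  "carrier (tensor_space (tensor_space U V) W) = carrier ((U \<boxtimes>\<^bsub>H\<^esub> V) \<boxtimes>\<^bsub>H\<^esub> W)"
proof -
  have "carrier (tensor_space U V) = carrier (U \<boxtimes>\<^bsub>H\<^esub> V)"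
    by (simp add: tensor_hmod_simps) (simp add: tensor_space_def)
  thus ?thesis
    unfolding tensor_hmod_simps(1)[of _ H W] tens_tensor_space(1)[symmetric]
    by (simp add: tensor_space_def)
qed

section \<open>The associator\<close>

text \<open>
  A list of triples \<open>(u, v, w)\<close> represents the sum of the \<open>(u \<otimes> v) \<otimes> w\<close> in one bracketing and the
  sum of the \<open>u \<otimes> (v \<otimes> w)\<close> in the other.
\<close>

abbreviation triples_left ::
  "('h, 'v) hmod \<Rightarrow> ('h, 'v) hmod \<Rightarrow> ('v vec \<times> 'v vec \<times> 'v vec) list \<Rightarrow> ('v vec \<times> 'v vec) list"
  where "triples_left U V \<equiv> map (\<lambda>(u, v, w). (tens U V [(u, v)], w))"

abbreviation triples_right ::
  "('h, 'v) hmod \<Rightarrow> ('h, 'v) hmod \<Rightarrow> ('v vec \<times> 'v vec \<times> 'v vec) list \<Rightarrow> ('v vec \<times> 'v vec) list"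
  where "triples_right V W \<equiv> map (\<lambda>(u, v, w). (u, tens V W [(v, w)]))"

lemma triples_lists:
  assumes "l \<in> lists (carrier U \<times> carrier V \<times> carrier W)"
  shows "triples_left U V l \<in> lists (carrier (U \<boxtimes>\<^bsub>H\<^esub> V) \<times> carrier W)"
    and "triples_right V W l \<in> lists (carrier U \<times> carrier (V \<boxtimes>\<^bsub>H\<^esub> W))"
  using assms by (auto simp: in_lists_conv_set)

text \<open>
  If every pure tensor is a sum of elements \<open>g a\<close>, then so is every tensor. In the next two lemmas
  this shows that a triple tensor product is spanned by \<open>(u \<otimes> v) \<otimes> w\<close>, respectively
  \<open>u \<otimes> (v \<otimes> w)\<close>.
\<close>

lemma tensor_eq_generators:
  assumes single: "\<And>v w. \<lbrakk>v \<in> carrier V; w \<in> carrier W\<rbrakk> \<Longrightarrow>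
      \<exists>l\<in>lists A. tensor_eq V W [(v, w)] (map g l)"
    and t: "t \<in> carrier (V \<boxtimes>\<^bsub>H\<^esub> W)"
  obtains l where "l \<in> lists A" and "t = tens V W (map g l)"
proof -
  obtain z where z: "z \<in> lists (carrier V \<times> carrier W)" and t_eq: "t = tens V W z"
    using t unfolding tensor_hmod_simps(1) by blast
  have "\<exists>l\<in>lists A. tensor_eq V W z (map g l)"
    using z
  proof (induction z)
    case Nil
    have "tensor_eq V W [] (map g [])"
      by (simp add: tensor_eq.refl)
    thus ?case by (rule bexI) simp
  next
    case (Cons a z)
    obtain l where l: "l \<in> lists A" "tensor_eq V W [a] (map g l)"
      using single Cons(1) by blast
    obtain l' where l': "l' \<in> lists A" "tensor_eq V W z (map g l')"
      using Cons by blast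
    have "tensor_eq V W ([a] @ z) (map g l @ map g l')"
      by (rule tensor_eq.append) (rule l l')+
    thus ?case
      using l l' by (intro bexI[of _ "l @ l'"]) auto
  qed
  thus ?thesis
    using that t_eq tens_eqI by metis
qed

lemma tensor_triples_left:
  assumes t: "t \<in> carrier ((U \<boxtimes>\<^bsub>H\<^esub> V) \<boxtimes>\<^bsub>H\<^esub> W)"
  obtains l where "l \<in> lists (carrier U \<times> carrier V \<times> carrier W)"
    and "t = tens (U \<boxtimes>\<^bsub>H\<^esub> V) W (triples_left U V l)"
proof -
  have single: "\<exists>l\<in>lists (carrier U \<times> carrier V \<times> carrier W).
      tensor_eq (U \<boxtimes>\<^bsub>H\<^esub> V) W [(tens U V x, w)] (triples_left U V l)"
    if x: "x \<in> lists (carrier U \<times> carrier V)" and w: "w \<in> carrier W" for x w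
    using x
  proof (induction x)
    case Nil
    have "tensor_eq (U \<boxtimes>\<^bsub>H\<^esub> V) W [(tens U V [], w)] (triples_left U V [])"
      using tensor_eq.zero[OF w, of "U \<boxtimes>\<^bsub>H\<^esub> V"] by (simp add: tensor_hmod_simps(2))
    thus ?case by (rule bexI) simp
  next
    case (Cons a x)
    obtain u v where a: "a = (u, v)" by (cases a)
    with Cons obtain l where l: "l \<in> lists (carrier U \<times> carrier V \<times> carrier W)"
      and eq: "tensor_eq (U \<boxtimes>\<^bsub>H\<^esub> V) W [(tens U V x, w)] (triples_left U V l)"
      by blast
    have uv: "u \<in> carrier U" "v \<in> carrier V" and x: "x \<in> lists (carrier U \<times> carrier V)"
      using Cons a by auto
    have "tensor_eq (U \<boxtimes>\<^bsub>H\<^esub> V) W [(tens U V (a # x), w)] ([(tens U V [a], w)] @ [(tens U V x, w)])"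
      using tensor_eq.add_left[of "tens U V [a]" "U \<boxtimes>\<^bsub>H\<^esub> V" "tens U V x" w W] uv x w
        tensor_add[of "[a]" U V x H]
      by (simp add: a)
    moreover have "tensor_eq (U \<boxtimes>\<^bsub>H\<^esub> V) W
        ([(tens U V [a], w)] @ [(tens U V x, w)]) ([(tens U V [a], w)] @ triples_left U V l)"
      by (intro tensor_eq.append tensor_eq.refl eq) (use uv w a in auto)
    ultimately have "tensor_eq (U \<boxtimes>\<^bsub>H\<^esub> V) W [(tens U V (a # x), w)]
        (triples_left U V ((u, v, w) # l))"
      by (simp add: a) (rule tensor_eq.trans)
    thus ?case
      by (rule bexI) (use l uv w in simp)
  qed
  show ?thesis
    by (rule tensor_eq_generators[OF _ t]) (use single that in \<open>auto simp: tensor_hmod_simps(1)\<close>)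
qed

lemma tensor_triples_right:
  assumes U: "complex_space U" and VW: "complex_space (V \<boxtimes>\<^bsub>H\<^esub> W)"
    and t: "t \<in> carrier (U \<boxtimes>\<^bsub>H\<^esub> (V \<boxtimes>\<^bsub>H\<^esub> W))"
  obtains l where "l \<in> lists (carrier U \<times> carrier V \<times> carrier W)"
    and "t = tens U (V \<boxtimes>\<^bsub>H\<^esub> W) (triples_right V W l)"
proof -
  have single: "\<exists>l\<in>lists (carrier U \<times> carrier V \<times> carrier W).
      tensor_eq U (V \<boxtimes>\<^bsub>H\<^esub> W) [(u, tens V W x)] (triples_right V W l)"
    if x: "x \<in> lists (carrier V \<times> carrier W)" and u: "u \<in> carrier U" for x u
    using x
  proof (induction x)
    case Nil
    have "tensor_eq U (V \<boxtimes>\<^bsub>H\<^esub> W) [(u, tens V W [])] (triples_right V W [])"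
      using tensor_eq_zero_right[OF U VW u] by (simp add: tensor_hmod_simps(2))
    thus ?case by (rule bexI) simp
  next
    case (Cons a x)
    obtain v w where a: "a = (v, w)" by (cases a)
    with Cons obtain l where l: "l \<in> lists (carrier U \<times> carrier V \<times> carrier W)"
      and eq: "tensor_eq U (V \<boxtimes>\<^bsub>H\<^esub> W) [(u, tens V W x)] (triples_right V W l)"
      by blast
    have vw: "v \<in> carrier V" "w \<in> carrier W" and x: "x \<in> lists (carrier V \<times> carrier W)"
      using Cons a by auto
    have "tensor_eq U (V \<boxtimes>\<^bsub>H\<^esub> W) [(u, tens V W (a # x))] ([(u, tens V W [a])] @ [(u, tens V W x)])"
      using tensor_eq.add_right[of u U "tens V W [a]" "V \<boxtimes>\<^bsub>H\<^esub> W" "tens V W x"] vw x u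
        tensor_add[of "[a]" V W x H]
      by (simp add: a)
    moreover have "tensor_eq U (V \<boxtimes>\<^bsub>H\<^esub> W)
        ([(u, tens V W [a])] @ [(u, tens V W x)]) ([(u, tens V W [a])] @ triples_right V W l)"
      by (intro tensor_eq.append tensor_eq.refl eq) (use vw u a in auto)
    ultimately have "tensor_eq U (V \<boxtimes>\<^bsub>H\<^esub> W) [(u, tens V W (a # x))]
        (triples_right V W ((u, v, w) # l))"
      by (simp add: a) (rule tensor_eq.trans)
    thus ?case
      by (rule bexI) (use l vw u in simp)
  qed
  show ?thesis
    by (rule tensor_eq_generators[OF _ t]) (use single that in \<open>auto simp: tensor_hmod_simps(1)\<close>)
qed

text \<open>
  The associator is induced by a bilinear map in two stages. For fixed \<open>w\<close>, the map \<open>\<Psi> w\<close>, given by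
  \<open>u \<otimes> v \<mapsto> u \<otimes> (v \<otimes> w)\<close>, respects the relations of \<open>U \<otimes> V\<close>. Hence \<open>\<Psi> w\<close> may be evaluated on any
  representative of an element of \<open>U \<otimes> V\<close>, and this is used to show that the total map \<open>\<Phi>\<close>
  respects the relations of \<open>(U \<otimes> V) \<otimes> W\<close>.
\<close>

lemma assoc_triples:
  fixes U V W :: "('h, 'v) hmod"
  assumes U: "complex_space U" and V: "complex_space V" and W: "complex_space W"
    and VW: "complex_space (V \<boxtimes>\<^bsub>H\<^esub> W)"
    and l: "l \<in> lists (carrier U \<times> carrier V \<times> carrier W)"
  shows "fn (assoc_arrow H U V W) (tens (U \<boxtimes>\<^bsub>H\<^esub> V) W (triples_left U V l)) =
    tens U (V \<boxtimes>\<^bsub>H\<^esub> W) (triples_right V W l)"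
proof -
  let ?UV = "U \<boxtimes>\<^bsub>H\<^esub> V" and ?VW = "V \<boxtimes>\<^bsub>H\<^esub> W"
  define \<Psi> :: "'v vec \<Rightarrow> ('v vec \<times> 'v vec) list \<Rightarrow> ('v vec \<times> 'v vec) list"
    where "\<Psi> = (\<lambda>w. map (\<lambda>(u, v). (u, tens V W [(v, w)])))"
  define \<Phi> where "\<Phi> = (\<lambda>z. concat (map (\<lambda>(s, w). \<Psi> w (untens s)) z))"
  have app: "\<Phi> (x @ y) = \<Phi> x @ \<Phi> y" for x y
    by (simp add: \<Phi>_def)
  have app2: "\<Phi> [p, q] = \<Phi> [p] @ \<Phi> [q]" for p q
    using app[of "[p]" "[q]"] by simp
  have \<Psi>_app: "\<Psi> w (x @ y) = \<Psi> w x @ \<Psi> w y" for w x y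
    by (simp add: \<Psi>_def)
  have inner: "tensor_eq U ?VW (\<Psi> w x) (\<Psi> w y)" if "w \<in> carrier W" "tensor_eq U V x y" for w x y
    using that(2)
  proof (rule tensor_eq_bilinear[where \<Phi> = "\<Psi> w", rotated -1])
    fix u v v' assume "u \<in> carrier U" "v \<in> carrier V" "v' \<in> carrier V"
    moreover have "tens V W [(v \<oplus>\<^bsub>V\<^esub> v', w)] = tens V W [(v, w)] \<oplus>\<^bsub>?VW\<^esub> tens V W [(v', w)]"
      if "v \<in> carrier V" "v' \<in> carrier V"
      using that \<open>w \<in> carrier W\<close>
      by (simp add: tensor_add tens_eqI[OF tensor_eq.add_left])
    ultimately show "tensor_eq U ?VW (\<Psi> w [(u, v \<oplus>\<^bsub>V\<^esub> v')]) (\<Psi> w [(u, v), (u, v')])"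
      using that(1) tensor_eq.add_right[of u U "tens V W [(v, w)]" ?VW "tens V W [(v', w)]"]
      by (simp add: \<Psi>_def)
  next
    fix c u v assume uv: "u \<in> carrier U" "v \<in> carrier V"
    have "c \<odot>\<^bsub>?VW\<^esub> tens V W [(v, w)] = tens V W [(c \<odot>\<^bsub>V\<^esub> v, w)]"
      using uv that(1) by (simp add: tensor_smult_left V)
    thus "tensor_eq U ?VW (\<Psi> w [(c \<odot>\<^bsub>U\<^esub> u, v)]) (\<Psi> w [(u, c \<odot>\<^bsub>V\<^esub> v)])"
      using uv that(1) tensor_eq.scale[of u U "tens V W [(v, w)]" ?VW c]
      by (simp add: \<Psi>_def)
  qed (use that(1) in \<open>auto simp: \<Psi>_def intro!: tensor_eq.intros(6,7)\<close>)
  have rep: "tensor_eq U ?VW (\<Phi> [(tens U V x, w)]) (\<Psi> w x)" "\<Psi> w x \<in> lists (carrier U \<times> carrier ?VW)"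
    if "x \<in> lists (carrier U \<times> carrier V)" "w \<in> carrier W" for x w
  proof -
    show "tensor_eq U ?VW (\<Phi> [(tens U V x, w)]) (\<Psi> w x)"
      using inner[OF that(2) tensor_eq.sym[OF tensor_eq_untens_tens[OF that(1)]]]
      by (simp add: \<Phi>_def)
    show "\<Psi> w x \<in> lists (carrier U \<times> carrier ?VW)"
      using that by (auto simp: \<Psi>_def in_lists_conv_set)
  qed
  have outer: "tensor_eq U ?VW (\<Phi> x) (\<Phi> y)" if "tensor_eq ?UV W x y" for x y
    using that
  proof (rule tensor_eq_bilinear[where \<Phi> = \<Phi>, rotated -1])
    fix s w assume s: "s \<in> carrier ?UV" and w: "w \<in> carrier W"
    then obtain x where x: "x \<in> lists (carrier U \<times> carrier V)" "s = tens U V x"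
      by (auto simp: tensor_hmod_simps(1))
    show "\<Phi> [(s, w)] \<in> lists (carrier U \<times> carrier ?VW)"
      using tensor_eq_lists[OF U VW rep(1)[OF x(1) w]] x(2) by simp
  next
    fix w assume w: "w \<in> carrier W"
    show "tensor_eq U ?VW (\<Phi> [(\<zero>\<^bsub>?UV\<^esub>, w)]) []"
      using rep(1)[of "[]" w] w by (simp add: tensor_hmod_simps(2) \<Psi>_def)
  next
    fix s s' w assume s: "s \<in> carrier ?UV" and s': "s' \<in> carrier ?UV" and w: "w \<in> carrier W"
    obtain x where x: "x \<in> lists (carrier U \<times> carrier V)" "s = tens U V x"
      using s by (auto simp: tensor_hmod_simps(1))
    obtain x' where x': "x' \<in> lists (carrier U \<times> carrier V)" "s' = tens U V x'"
      using s' by (auto simp: tensor_hmod_simps(1))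
    have sum: "s \<oplus>\<^bsub>?UV\<^esub> s' = tens U V (x @ x')"
      unfolding x(2) x'(2) by (rule tensor_add) (rule x x')+
    have "tensor_eq U ?VW (\<Phi> [(s \<oplus>\<^bsub>?UV\<^esub> s', w)]) (\<Psi> w (x @ x'))"
      unfolding sum by (rule rep) (use x(1) x'(1) w in auto)
    moreover have "tensor_eq U ?VW (\<Phi> [(s, w)] @ \<Phi> [(s', w)]) (\<Psi> w x @ \<Psi> w x')"
      unfolding x x' by (intro tensor_eq.append rep x x' w)
    ultimately show "tensor_eq U ?VW (\<Phi> [(s \<oplus>\<^bsub>?UV\<^esub> s', w)]) (\<Phi> [(s, w), (s', w)])"
      unfolding app2 \<Psi>_app by (blast intro: tensor_eq.sym tensor_eq.trans)
  next
    fix s w w' assume s: "s \<in> carrier ?UV" and w: "w \<in> carrier W" and w': "w' \<in> carrier W"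
    obtain x where x: "x \<in> lists (carrier U \<times> carrier V)" "s = tens U V x"
      using s by (auto simp: tensor_hmod_simps(1))
    have ww': "w \<oplus>\<^bsub>W\<^esub> w' \<in> carrier W"
      using w w' by (simp add: complex_space_simps[OF W])
    have "tensor_eq U ?VW (\<Psi> (w \<oplus>\<^bsub>W\<^esub> w') x) (\<Psi> w x @ \<Psi> w' x)"
      using x(1)
    proof (induction x)
      case Nil
      show ?case by (simp add: \<Psi>_def tensor_eq.refl)
    next
      case (Cons a x)
      obtain u v where a: "a = (u, v)" by (cases a)
      have uv: "u \<in> carrier U" "v \<in> carrier V" and x: "x \<in> lists (carrier U \<times> carrier V)"
        using Cons a by auto
      have "tens V W [(v, w \<oplus>\<^bsub>W\<^esub> w')] = tens V W [(v, w)] \<oplus>\<^bsub>?VW\<^esub> tens V W [(v, w')]"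
        using uv w w' by (simp add: tensor_add tens_eqI[OF tensor_eq.add_right])
      hence "tensor_eq U ?VW (\<Psi> (w \<oplus>\<^bsub>W\<^esub> w') [a]) (\<Psi> w [a] @ \<Psi> w' [a])"
        using tensor_eq.add_right[of u U "tens V W [(v, w)]" ?VW "tens V W [(v, w')]"] uv w w'
        by (simp add: \<Psi>_def a)
      with Cons have "tensor_eq U ?VW (\<Psi> (w \<oplus>\<^bsub>W\<^esub> w') [a] @ \<Psi> (w \<oplus>\<^bsub>W\<^esub> w') x)
          ((\<Psi> w [a] @ \<Psi> w' [a]) @ (\<Psi> w x @ \<Psi> w' x))"
        by (intro tensor_eq.append)
      moreover have "tensor_eq U ?VW (\<Psi> w [a] @ (\<Psi> w' [a] @ \<Psi> w x) @ \<Psi> w' x)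
          (\<Psi> w [a] @ (\<Psi> w x @ \<Psi> w' [a]) @ \<Psi> w' x)"
        by (intro tensor_eq.append tensor_eq.refl tensor_eq.comm rep(2)) (use uv x w w' a in auto)
      ultimately show ?case
        unfolding \<Psi>_app[of _ "[a]" x, simplified] append_assoc by (rule tensor_eq.trans)
    qed
    moreover have "tensor_eq U ?VW (\<Phi> [(s, w \<oplus>\<^bsub>W\<^esub> w')]) (\<Psi> (w \<oplus>\<^bsub>W\<^esub> w') x)"
      unfolding x by (intro rep x ww')
    moreover have "tensor_eq U ?VW (\<Phi> [(s, w)] @ \<Phi> [(s, w')]) (\<Psi> w x @ \<Psi> w' x)"
      unfolding x by (intro tensor_eq.append rep x w w')
    ultimately show "tensor_eq U ?VW (\<Phi> [(s, w \<oplus>\<^bsub>W\<^esub> w')]) (\<Phi> [(s, w), (s, w')])"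
      unfolding app2 by (blast intro: tensor_eq.sym tensor_eq.trans)
  next
    fix c s w assume s: "s \<in> carrier ?UV" and w: "w \<in> carrier W"
    obtain x where x: "x \<in> lists (carrier U \<times> carrier V)" "s = tens U V x"
      using s by (auto simp: tensor_hmod_simps(1))
    let ?cx = "map (\<lambda>(u, v). (c \<odot>\<^bsub>U\<^esub> u, v)) x"
    have cx: "?cx \<in> lists (carrier U \<times> carrier V)" and cw: "c \<odot>\<^bsub>W\<^esub> w \<in> carrier W"
      using x w by (auto simp: in_lists_conv_set complex_space_simps[OF U] complex_space_simps[OF W])
    have "tensor_eq U ?VW (\<Psi> w ?cx) (\<Psi> (c \<odot>\<^bsub>W\<^esub> w) x)"
      using x(1)
    proof (induction x)
      case Nil
      show ?case by (simp add: \<Psi>_def tensor_eq.refl)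
    next
      case (Cons a x)
      obtain u v where a: "a = (u, v)" by (cases a)
      have uv: "u \<in> carrier U" "v \<in> carrier V"
        using Cons a by auto
      have "tensor_eq U ?VW [(c \<odot>\<^bsub>U\<^esub> u, tens V W [(v, w)])] [(u, tens V W [(v, c \<odot>\<^bsub>W\<^esub> w)])]"
        using tensor_eq.scale[of u U "tens V W [(v, w)]" ?VW c] uv w
        by (simp add: tensor_smult_right V)
      from tensor_eq.append[OF this Cons.IH] show ?case
        by (simp add: \<Psi>_def a)
    qed
    moreover have "tensor_eq U ?VW (\<Phi> [(c \<odot>\<^bsub>?UV\<^esub> s, w)]) (\<Psi> w ?cx)"
      unfolding x(2) tensor_smult_left[OF U x(1)] by (intro rep cx w)
    moreover have "tensor_eq U ?VW (\<Phi> [(s, c \<odot>\<^bsub>W\<^esub> w)]) (\<Psi> (c \<odot>\<^bsub>W\<^esub> w) x)"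
      unfolding x by (intro rep x cw)
    ultimately show "tensor_eq U ?VW (\<Phi> [(c \<odot>\<^bsub>?UV\<^esub> s, w)]) (\<Phi> [(s, c \<odot>\<^bsub>W\<^esub> w)])"
      by (blast intro: tensor_eq.sym tensor_eq.trans)
  qed (rule app)
  have "tensor_eq U ?VW (\<Phi> (triples_left U V l)) (triples_right V W l)"
    using l
  proof (induction l)
    case Nil
    show ?case by (simp add: \<Phi>_def tensor_eq.refl)
  next
    case (Cons a l)
    obtain u v w where a: "a = (u, v, w)" by (cases a)
    have "tensor_eq U ?VW (\<Phi> [(tens U V [(u, v)], w)]) (\<Psi> w [(u, v)])"
      using rep(1) Cons a by auto
    then have "tensor_eq U ?VW (\<Phi> [(tens U V [(u, v)], w)] @ \<Phi> (triples_left U V l))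
        (\<Psi> w [(u, v)] @ triples_right V W l)"
      by (intro tensor_eq.append Cons.IH) (use Cons.hyps in auto)
    moreover have "\<Phi> [(tens U V [(u, v)], w)] @ \<Phi> (triples_left U V l) =
        \<Phi> (triples_left U V (a # l))"
      by (simp add: a \<Phi>_def)
    moreover have "\<Psi> w [(u, v)] @ triples_right V W l = triples_right V W (a # l)"
      by (simp add: a \<Psi>_def)
    ultimately show ?case by (simp only:)
  qed
  moreover have "tensor_eq U ?VW (\<Phi> (untens (tens ?UV W (triples_left U V l)))) (\<Phi> (triples_left U V l))"
    by (intro outer tensor_eq.sym[OF tensor_eq_untens_tens] triples_lists l)
  ultimately have "tensor_eq U ?VW (\<Phi> (untens (tens ?UV W (triples_left U V l)))) (triples_right V W l)"
    by (blast intro: tensor_eq.trans)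
  moreover have "tens ?UV W (triples_left U V l) \<in> carrier (tensor_space (tensor_space U V) W)"
    unfolding carrier_tensor_space_left[where H = H]
    by (intro tens_closed triples_lists l)
  ultimately show ?thesis
    by (simp add: assoc_arrow_def assoc_map_def tens_tensor_space[where H = H]
        \<Phi>_def \<Psi>_def tens_eqI)
qed

section \<open>Composites, tensor products and conjugates of arrows\<close>

lemma arrow_eqI:
  fixes f g :: "('h, 'v) arrow"
  assumes "source f = source g" "target f = target g"
    and "fn f \<in> extensional (carrier (source f))" "fn g \<in> extensional (carrier (source f))"
    and "\<And>t. t \<in> carrier (source f) \<Longrightarrow> fn f t = fn g t"
  shows "f = g"
proof -
  have "fn f = fn g"
    by (rule extensionalityI) (use assms in auto)
  with assms(1,2) show ?thesis
    by (cases f; cases g) simp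
qed

lemma arrow_simps [simp]:
  "source (g \<bullet> f) = source f" "target (g \<bullet> f) = target g"
  "source (id_arrow V) = V" "target (id_arrow V) = V"
  "source (inv_arrow f) = target f" "target (inv_arrow f) = source f"
  "source (f \<star>\<^bsub>H\<^esub> g) = source f \<boxtimes>\<^bsub>H\<^esub> source g"
  "target (f \<star>\<^bsub>H\<^esub> g) = target f \<boxtimes>\<^bsub>H\<^esub> target g"
  "source (assoc_arrow H U V W) = (U \<boxtimes>\<^bsub>H\<^esub> V) \<boxtimes>\<^bsub>H\<^esub> W"
  "target (assoc_arrow H U V W) = U \<boxtimes>\<^bsub>H\<^esub> (V \<boxtimes>\<^bsub>H\<^esub> W)"
  "source (conj_arrow H f) = conj_hmod H (source f)"
  "target (conj_arrow H f) = conj_hmod H (target f)"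
  "source (rho_arrow H V W) = conj_hmod H (V \<boxtimes>\<^bsub>H\<^esub> W)"
  "target (rho_arrow H V W) = conj_hmod H W \<boxtimes>\<^bsub>H\<^esub> conj_hmod H V"
  "source (sigma_arrow H V) = conj_hmod H (conj_hmod H V)"
  "target (sigma_arrow H V) = V"
  by (simp_all add: comp_arrow_def id_arrow_def inv_arrow_def tensor_arrow_def assoc_arrow_def
      conj_arrow_def rho_arrow_def sigma_arrow_def)

lemma fn_simps [simp]:
  "t \<in> carrier (source f) \<Longrightarrow> fn (g \<bullet> f) t = fn g (fn f t)"
  "v \<in> carrier V \<Longrightarrow> fn (id_arrow V) v = v"
  "v \<in> carrier (source f) \<Longrightarrow> fn (conj_arrow H f) (Bar v) = Bar (fn f v)"
  "v \<in> carrier V \<Longrightarrow> fn (sigma_arrow H V) (Bar (Bar v)) = v"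
  by (simp_all add: comp_arrow_def id_arrow_def conj_arrow_def sigma_arrow_def compose_def
      conj_hmod_simps)

lemma fn_extensional:
  "fn (g \<bullet> f) \<in> extensional (carrier (source f))"
  "fn (id_arrow V) \<in> extensional (carrier V)"
  "fn (conj_arrow H f) \<in> extensional (carrier (conj_hmod H (source f)))"
  by (simp_all add: comp_arrow_def id_arrow_def conj_arrow_def)

lemma tensor_arrow_extensional:
  "fn (f \<star>\<^bsub>H\<^esub> g) \<in> extensional (carrier (source f \<boxtimes>\<^bsub>H\<^esub> source g))"
proof -
  have "carrier (source f \<boxtimes>\<^bsub>H\<^esub> source g) = carrier (tensor_space (source f) (source g))"
    by (simp add: tensor_hmod_simps) (simp add: tensor_space_def)
  thus ?thesis
    by (simp add: tensor_arrow_def tensor_map_def)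
qed

lemma hmod_arrowD:
  assumes "hmod_arrow H f"
  shows "complex_space (source f)" "complex_space (target f)"
    and "linear_map (source f) (target f) (fn f)"
    and "fn f \<in> extensional (carrier (source f))"
    and "t \<in> carrier (source f) \<Longrightarrow> fn f t \<in> carrier (target f)"
  using assms by (auto simp: hmod_arrow_def hmodule_def linear_map_def PiE_def)

lemma comp_assoc:
  assumes "hmod_arrow H f" "source g = target f"
  shows "(h \<bullet> g) \<bullet> f = h \<bullet> (g \<bullet> f)"
  by (rule arrow_eqI) (use hmod_arrowD(5)[OF assms(1)] assms(2) fn_extensional(1)[of "h \<bullet> g" f]
      fn_extensional(1)[of h "g \<bullet> f"] in auto)

lemma comp_id:
  assumes "hmod_arrow H f"
  shows "f \<bullet> id_arrow (source f) = f" "id_arrow (target f) \<bullet> f = f"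
  by (rule arrow_eqI; use hmod_arrowD(4,5)[OF assms] in \<open>simp add: fn_extensional(1)\<close>;
      use fn_extensional(1)[of f "id_arrow (source f)"] in simp)+

lemma tensor_arrow_tens:
  assumes "hmod_arrow H f" "hmod_arrow H g"
    and "x \<in> lists (carrier (source f) \<times> carrier (source g))"
  shows "fn (f \<star>\<^bsub>H\<^esub> g) (tens (source f) (source g) x) =
      tens (target f) (target g) (map (\<lambda>(v, w). (fn f v, fn g w)) x)"
    and "map (\<lambda>(v, w). (fn f v, fn g w)) x \<in> lists (carrier (target f) \<times> carrier (target g))"
  using tensor_map_tens[of "source f" "target f" "fn f" "source g" "target g" "fn g" x]
    hmod_arrowD[OF assms(1)] hmod_arrowD[OF assms(2)] assms(3)
  by (simp_all add: tensor_arrow_def)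

lemma comp_hmod_arrow:
  assumes "hmod_arrow H f" "hmod_arrow H g" "source g = target f"
  shows "hmod_arrow H (g \<bullet> f)"
proof -
  interpret V: hmodule H "source f" using assms(1) by (simp add: hmod_arrow_def)
  have closed: "x \<oplus>\<^bsub>source f\<^esub> y \<in> carrier (source f)" "c \<odot>\<^bsub>source f\<^esub> x \<in> carrier (source f)"
    if "x \<in> carrier (source f)" "y \<in> carrier (source f)" for x y c
    using that complex_space_simps(2,3)[OF hmod_arrowD(1)[OF assms(1)]] by auto
  show ?thesis
    using assms hmod_arrowD(5)[OF assms(1)] hmod_arrowD(5)[OF assms(2)]
      fn_extensional(1)[of g f] closed V.act_closed
    by (simp add: hmod_arrow_def linear_map_def PiE_def Pi_def)
qed

lemma tensor_arrow_comp:
  assumes f: "hmod_arrow H f" "hmod_arrow H f'" and g: "hmod_arrow H g" "hmod_arrow H g'"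
    and st: "source g = target f" "source g' = target f'"
  shows "(g \<star>\<^bsub>H\<^esub> g') \<bullet> (f \<star>\<^bsub>H\<^esub> f') = (g \<bullet> f) \<star>\<^bsub>H\<^esub> (g' \<bullet> f')"
proof (rule arrow_eqI)
  fix t assume "t \<in> carrier (source ((g \<star>\<^bsub>H\<^esub> g') \<bullet> (f \<star>\<^bsub>H\<^esub> f')))"
  then obtain x where x: "x \<in> lists (carrier (source f) \<times> carrier (source f'))"
    and t: "t = tens (source f) (source f') x"
    by (auto simp: tensor_hmod_simps)
  let ?x = "map (\<lambda>(v, w). (fn f v, fn f' w)) x"
  have "fn ((g \<star>\<^bsub>H\<^esub> g') \<bullet> (f \<star>\<^bsub>H\<^esub> f')) t = fn (g \<star>\<^bsub>H\<^esub> g') (tens (source g) (source g') ?x)"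
    using x t by (simp add: tensor_arrow_tens(1)[OF f x] st)
  also have "\<dots> = tens (target g) (target g') (map (\<lambda>(v, w). (fn g v, fn g' w)) ?x)"
    by (rule tensor_arrow_tens(1)[OF g]) (unfold st, rule tensor_arrow_tens(2)[OF f x])
  also have "map (\<lambda>(v, w). (fn g v, fn g' w)) ?x = map (\<lambda>(v, w). (fn (g \<bullet> f) v, fn (g' \<bullet> f') w)) x"
    using x by (auto simp: in_lists_conv_set)
  also have "tens (target g) (target g') \<dots> = fn ((g \<bullet> f) \<star>\<^bsub>H\<^esub> (g' \<bullet> f')) t"
    using tensor_arrow_tens(1)[of H "g \<bullet> f" "g' \<bullet> f'" x] f g st x
    by (simp add: comp_hmod_arrow t)
  finally show "fn ((g \<star>\<^bsub>H\<^esub> g') \<bullet> (f \<star>\<^bsub>H\<^esub> f')) t = fn ((g \<bullet> f) \<star>\<^bsub>H\<^esub> (g' \<bullet> f')) t" .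
qed (use fn_extensional(1)[of "g \<star>\<^bsub>H\<^esub> g'" "f \<star>\<^bsub>H\<^esub> f'"]
      tensor_arrow_extensional[of "g \<bullet> f" H "g' \<bullet> f'"] in auto)

lemma id_arrow_hmod:
  assumes "hmodule H V"
  shows "hmod_arrow H (id_arrow V)"
proof -
  interpret hmodule H V by fact
  have "complex_space V" by unfold_locales
  note V = complex_space_simps[OF this]
  show ?thesis
    using assms fn_extensional(2)[of V] act_closed
    by (simp add: hmod_arrow_def linear_map_def PiE_def Pi_def V(2,3))
qed

lemma tensor_arrow_id:
  assumes "hmodule H V" "hmodule H W"
  shows "id_arrow V \<star>\<^bsub>H\<^esub> id_arrow W = id_arrow (V \<boxtimes>\<^bsub>H\<^esub> W)"
proof (rule arrow_eqI)
  fix t assume "t \<in> carrier (source (id_arrow V \<star>\<^bsub>H\<^esub> id_arrow W))"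
  then obtain x where x: "x \<in> lists (carrier V \<times> carrier W)" and t: "t = tens V W x"
    by (auto simp: tensor_hmod_simps)
  have "map (\<lambda>(v, w). (fn (id_arrow V) v, fn (id_arrow W) w)) x = x"
    using x by (intro map_idI) (auto simp: in_lists_conv_set)
  thus "fn (id_arrow V \<star>\<^bsub>H\<^esub> id_arrow W) t = fn (id_arrow (V \<boxtimes>\<^bsub>H\<^esub> W)) t"
    using tensor_arrow_tens(1)[of H "id_arrow V" "id_arrow W" x] x t
    by (simp add: id_arrow_hmod assms)
qed (use fn_extensional(2)[of "V \<boxtimes>\<^bsub>H\<^esub> W"] tensor_arrow_extensional[of "id_arrow V" H "id_arrow W"]
      in auto)

lemma conj_arrow_id: "conj_arrow H (id_arrow V) = id_arrow (conj_hmod H V)"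
  by (rule arrow_eqI) (use fn_extensional(3)[of H "id_arrow V"]
      fn_extensional(2)[of "conj_hmod H V"] in \<open>auto simp: conj_hmod_simps\<close>)

lemma conj_arrow_comp:
  assumes "hmod_arrow H f" "source g = target f"
  shows "conj_arrow H g \<bullet> conj_arrow H f = conj_arrow H (g \<bullet> f)"
  by (rule arrow_eqI) (use fn_extensional(1)[of "conj_arrow H g" "conj_arrow H f"]
      fn_extensional(3)[of H "g \<bullet> f"] hmod_arrowD(5)[OF assms(1)] assms(2) in
      \<open>auto simp: conj_hmod_simps\<close>)

lemma inv_arrow_fn:
  assumes "bij_betw (fn f) (carrier (source f)) (carrier (target f))"
  shows "t \<in> carrier (source f) \<Longrightarrow> fn (inv_arrow f) (fn f t) = t"
    and "s \<in> carrier (target f) \<Longrightarrow> fn f (fn (inv_arrow f) s) = s"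
    and "s \<in> carrier (target f) \<Longrightarrow> fn (inv_arrow f) s \<in> carrier (source f)"
  using assms bij_betw_inv_into_left[OF assms] bij_betw_inv_into_right[OF assms]
    bij_betwE[OF assms] bij_betwE[OF bij_betw_inv_into[OF assms]]
  by (simp_all add: inv_arrow_def)

lemma inv_arrow_comp:
  assumes "bij_betw (fn f) (carrier (source f)) (carrier (target f))"
  shows "inv_arrow f \<bullet> f = id_arrow (source f)" "f \<bullet> inv_arrow f = id_arrow (target f)"
   by (rule arrow_eqI; use inv_arrow_fn[OF assms] fn_extensional(1)[of "inv_arrow f" f]
        fn_extensional(1)[of f "inv_arrow f"] in \<open>simp add: fn_extensional(2)\<close>)+

lemma sigma_bij:
  "bij_betw (fn (sigma_arrow H V)) (carrier (source (sigma_arrow H V)))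
    (carrier (target (sigma_arrow H V)))"
  by (rule bij_betw_byWitness[where f' = "\<lambda>v. Bar (Bar v)"]) (auto simp: conj_hmod_simps)

section \<open>Categories closed under conjugation\<close>

text \<open>
  Membership in \<open>Obj C\<close> makes every tensor product and conjugate that occurs below an \<open>H\<close>-module,
  hence a complex vector space; this is where the closure properties of \<open>C\<close> enter the
  computations with elements.
\<close>

locale conjugation_category =
  fixes H :: "'h hopf_algebra" and C :: "('h, 'v) subcategory"
  assumes monoidal: "sub_monoidal_category H C"
    and conj_obj: "V \<in> Obj C \<Longrightarrow> conj_hmod H V \<in> Obj C"
    and conj_mor: "f \<in> Mor C \<Longrightarrow> conj_arrow H f \<in> Mor C"
    and rho_mor: "\<lbrakk>V \<in> Obj C; W \<in> Obj C\<rbrakk> \<Longrightarrow> rho_arrow H V W \<in> Mor C"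
    and inv_rho_mor: "\<lbrakk>V \<in> Obj C; W \<in> Obj C\<rbrakk> \<Longrightarrow> inv_arrow (rho_arrow H V W) \<in> Mor C"
    and sigma_mor: "V \<in> Obj C \<Longrightarrow> sigma_arrow H V \<in> Mor C"
    and inv_sigma_mor: "V \<in> Obj C \<Longrightarrow> inv_arrow (sigma_arrow H V) \<in> Mor C"
begin

abbreviation bar :: "('h, 'v) hmod \<Rightarrow> ('h, 'v) hmod"
  where "bar \<equiv> conj_hmod H"

abbreviation \<alpha> :: "('h, 'v) hmod \<Rightarrow> ('h, 'v) hmod \<Rightarrow> ('h, 'v) hmod \<Rightarrow> ('h, 'v) arrow"
  where "\<alpha> \<equiv> assoc_arrow H"

abbreviation \<rho> :: "('h, 'v) hmod \<Rightarrow> ('h, 'v) hmod \<Rightarrow> ('h, 'v) arrow"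
  where "\<rho> \<equiv> rho_arrow H"

abbreviation \<sigma> :: "('h, 'v) hmod \<Rightarrow> ('h, 'v) arrow"
  where "\<sigma> \<equiv> sigma_arrow H"

abbreviation \<tau> :: "('h, 'v) hmod \<Rightarrow> ('h, 'v) hmod \<Rightarrow> 'v vec \<Rightarrow> 'v vec"
  where "\<tau> V W t \<equiv> fn (\<rho> V W) (Bar t)"

lemma obj_hmodule: "V \<in> Obj C \<Longrightarrow> hmodule H V"
  and mor_arrow: "f \<in> Mor C \<Longrightarrow> hmod_arrow H f"
  and mor_obj [simp]: "f \<in> Mor C \<Longrightarrow> source f \<in> Obj C" "f \<in> Mor C \<Longrightarrow> target f \<in> Obj C"
  and id_mor [simp]: "V \<in> Obj C \<Longrightarrow> id_arrow V \<in> Mor C"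
  and comp_mor: "\<lbrakk>f \<in> Mor C; g \<in> Mor C; source g = target f\<rbrakk> \<Longrightarrow> g \<bullet> f \<in> Mor C"
  and tensor_obj [simp]: "\<lbrakk>V \<in> Obj C; W \<in> Obj C\<rbrakk> \<Longrightarrow> V \<boxtimes>\<^bsub>H\<^esub> W \<in> Obj C"
  and tensor_mor [simp]: "\<lbrakk>f \<in> Mor C; g \<in> Mor C\<rbrakk> \<Longrightarrow> f \<star>\<^bsub>H\<^esub> g \<in> Mor C"
  using monoidal unfolding sub_monoidal_category_def subcategory_hmod_def by blast+

declare conj_obj [simp] conj_mor [simp] rho_mor [simp] inv_rho_mor [simp]
  sigma_mor [simp] inv_sigma_mor [simp]

lemma obj_space: "V \<in> Obj C \<Longrightarrow> complex_space V"
  using obj_hmodule by (auto simp: hmodule_def)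

lemma mor_closed: "\<lbrakk>f \<in> Mor C; t \<in> carrier (source f)\<rbrakk> \<Longrightarrow> fn f t \<in> carrier (target f)"
  using hmod_arrowD(5) mor_arrow by blast

lemma tensor_comp:
  "\<lbrakk>f \<in> Mor C; f' \<in> Mor C; g \<in> Mor C; g' \<in> Mor C; source g = target f; source g' = target f'\<rbrakk> \<Longrightarrow>
    (g \<star>\<^bsub>H\<^esub> g') \<bullet> (f \<star>\<^bsub>H\<^esub> f') = (g \<bullet> f) \<star>\<^bsub>H\<^esub> (g' \<bullet> f')"
  by (intro tensor_arrow_comp mor_arrow)

lemma tensor_comp_fn:
  assumes "f \<in> Mor C" "f' \<in> Mor C" "g \<in> Mor C" "g' \<in> Mor C" "source g = target f" "source g' = target f'"
    and "t \<in> carrier (source f \<boxtimes>\<^bsub>H\<^esub> source f')"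
  shows "fn (g \<star>\<^bsub>H\<^esub> g') (fn (f \<star>\<^bsub>H\<^esub> f') t) = fn ((g \<bullet> f) \<star>\<^bsub>H\<^esub> (g' \<bullet> f')) t"
  using assms(7) by (simp flip: tensor_comp[OF assms(1-6)])

lemma tensor_id: "\<lbrakk>V \<in> Obj C; W \<in> Obj C\<rbrakk> \<Longrightarrow> id_arrow V \<star>\<^bsub>H\<^esub> id_arrow W = id_arrow (V \<boxtimes>\<^bsub>H\<^esub> W)"
  by (intro tensor_arrow_id obj_hmodule)

lemma mor_comp_id:
  assumes "f \<in> Mor C"
  shows "source f = V \<Longrightarrow> f \<bullet> id_arrow V = f" "target f = V \<Longrightarrow> id_arrow V \<bullet> f = f"
  using comp_id[OF mor_arrow[OF assms]] by auto

lemma iso_in_bij: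
  assumes "f \<in> Mor C" "inv_arrow f \<in> Mor C" "bij_betw (fn f) (carrier (source f)) (carrier (target f))"
  shows "iso_in C f" "iso_in C (inv_arrow f)"
  using assms(1,2) inv_arrow_comp[OF assms(3)] unfolding iso_in_def by force+

lemma iso_in_comp:
  assumes "iso_in C f" "iso_in C g" and st: "source g = target f"
  shows "iso_in C (g \<bullet> f)"
proof -
  obtain f' where f: "f \<in> Mor C" and f': "f' \<in> Mor C" "source f' = target f" "target f' = source f"
    "f' \<bullet> f = id_arrow (source f)" "f \<bullet> f' = id_arrow (target f)"
    using assms(1) by (auto simp: iso_in_def)
  obtain g' where g: "g \<in> Mor C" and g': "g' \<in> Mor C" "source g' = target g" "target g' = source g"
    "g' \<bullet> g = id_arrow (source g)" "g \<bullet> g' = id_arrow (target g)"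
    using assms(2) by (auto simp: iso_in_def)
  have assoc: "(k \<bullet> h) \<bullet> l = k \<bullet> (h \<bullet> l)" if "l \<in> Mor C" "source h = target l" for k h l
    using comp_assoc mor_arrow that by blast
  have "(f' \<bullet> g') \<bullet> (g \<bullet> f) = f' \<bullet> ((g' \<bullet> g) \<bullet> f)"
    by (simp add: assoc comp_mor f g f' g' st del: g'(4,5) f'(4,5))
  also have "\<dots> = id_arrow (source f)"
    by (simp add: g' f' st mor_comp_id f)
  finally have 1: "(f' \<bullet> g') \<bullet> (g \<bullet> f) = id_arrow (source f)" .
  have "(g \<bullet> f) \<bullet> (f' \<bullet> g') = g \<bullet> ((f \<bullet> f') \<bullet> g')"
    by (simp add: assoc comp_mor f g f' g' st del: g'(4,5) f'(4,5))
  also have "\<dots> = id_arrow (target g)"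
    by (simp add: g' f' mor_comp_id st flip: st)
  finally have 2: "(g \<bullet> f) \<bullet> (f' \<bullet> g') = id_arrow (target g)" .
  show ?thesis
    unfolding iso_in_def
    by (intro conjI bexI[of _ "f' \<bullet> g'"] comp_mor) (simp_all add: f g f' g' st 1 2)
qed

lemma iso_in_tensor:
  assumes "iso_in C f" "iso_in C g"
  shows "iso_in C (f \<star>\<^bsub>H\<^esub> g)"
proof -
  obtain f' where f: "f \<in> Mor C" and f': "f' \<in> Mor C" "source f' = target f" "target f' = source f"
    "f' \<bullet> f = id_arrow (source f)" "f \<bullet> f' = id_arrow (target f)"
    using assms(1) by (auto simp: iso_in_def)
  obtain g' where g: "g \<in> Mor C" and g': "g' \<in> Mor C" "source g' = target g" "target g' = source g"
    "g' \<bullet> g = id_arrow (source g)" "g \<bullet> g' = id_arrow (target g)"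
    using assms(2) by (auto simp: iso_in_def)
  show ?thesis
    unfolding iso_in_def
    by (intro conjI bexI[of _ "f' \<star>\<^bsub>H\<^esub> g'"]) (simp_all add: f g f' g' tensor_comp tensor_id)
qed

lemma iso_in_conj:
  assumes "iso_in C f"
  shows "iso_in C (conj_arrow H f)"
proof -
  obtain f' where f: "f \<in> Mor C" and f': "f' \<in> Mor C" "source f' = target f" "target f' = source f"
    "f' \<bullet> f = id_arrow (source f)" "f \<bullet> f' = id_arrow (target f)"
    using assms(1) by (auto simp: iso_in_def)
  show ?thesis
    unfolding iso_in_def
    by (intro conjI bexI[of _ "conj_arrow H f'"])
      (simp_all add: f f' conj_arrow_comp mor_arrow conj_arrow_id)
qed

lemma iso_in_bij_betw:
  assumes "iso_in C f"
  shows "bij_betw (fn f) (carrier (source f)) (carrier (target f))"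
proof -
  obtain f' where f: "f \<in> Mor C" and f': "f' \<in> Mor C" "source f' = target f" "target f' = source f"
    "f' \<bullet> f = id_arrow (source f)" "f \<bullet> f' = id_arrow (target f)"
    using assms(1) by (auto simp: iso_in_def)
  have "fn f' (fn f t) = t" if "t \<in> carrier (source f)" for t
    using fn_simps(1)[OF that, of f'] that f' by simp
  moreover have "fn f (fn f' t) = t" if "t \<in> carrier (target f)" for t
    using fn_simps(1)[of t f' f] that f' by simp
  ultimately show ?thesis
    using mor_closed[OF f] mor_closed[OF f'(1)] f'
    by (intro bij_betw_byWitness[where f' = "fn f'"]) auto
qed

lemma sigma_iso: "V \<in> Obj C \<Longrightarrow> iso_in C (\<sigma> V)" "V \<in> Obj C \<Longrightarrow> iso_in C (inv_arrow (\<sigma> V))"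
  by (intro iso_in_bij sigma_bij; simp)+

lemma tau_tens:
  assumes "V \<in> Obj C" "W \<in> Obj C" "x \<in> lists (carrier V \<times> carrier W)"
  shows "\<tau> V W (tens V W x) = tens (bar W) (bar V) (flip_bar x)"
  using assms rho_tens(1)[of H V W x] by (simp add: obj_space)

lemma tau_closed:
  "\<lbrakk>V \<in> Obj C; W \<in> Obj C; t \<in> carrier (V \<boxtimes>\<^bsub>H\<^esub> W)\<rbrakk> \<Longrightarrow> \<tau> V W t \<in> carrier (bar W \<boxtimes>\<^bsub>H\<^esub> bar V)"
  using mor_closed[of "\<rho> V W" "Bar t"] by (simp add: conj_hmod_simps(1)[of H "V \<boxtimes>\<^bsub>H\<^esub> W"])

text \<open>
  This is the naturality of \<open>\<rho>\<close>; the factors are exchanged on the right because \<open>\<tau>\<close> reverses the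
  order.
\<close>

lemma tau_natural:
  assumes f: "f \<in> Mor C" and g: "g \<in> Mor C" and t: "t \<in> carrier (source f \<boxtimes>\<^bsub>H\<^esub> source g)"
  shows "\<tau> (target f) (target g) (fn (f \<star>\<^bsub>H\<^esub> g) t) =
    fn (conj_arrow H g \<star>\<^bsub>H\<^esub> conj_arrow H f) (\<tau> (source f) (source g) t)"
proof -
  obtain x where x: "x \<in> lists (carrier (source f) \<times> carrier (source g))"
    and t: "t = tens (source f) (source g) x"
    using t by (auto simp: tensor_hmod_simps(1))
  note fg = tensor_arrow_tens[OF mor_arrow[OF f] mor_arrow[OF g] x]
  let ?y = "map (\<lambda>(v, w). (fn (conj_arrow H g) v, fn (conj_arrow H f) w)) (flip_bar x)"
  have "\<tau> (target f) (target g) (fn (f \<star>\<^bsub>H\<^esub> g) t) = tens (bar (target g)) (bar (target f))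
      (flip_bar (map (\<lambda>(v, w). (fn f v, fn g w)) x))"
    unfolding t fg(1) by (intro tau_tens fg) (simp_all add: f g)
  also have "flip_bar (map (\<lambda>(v, w). (fn f v, fn g w)) x) = ?y"
    using x by (auto simp: in_lists_conv_set)
  also have "tens (bar (target g)) (bar (target f)) ?y =
      fn (conj_arrow H g \<star>\<^bsub>H\<^esub> conj_arrow H f) (tens (bar (source g)) (bar (source f)) (flip_bar x))"
    using tensor_arrow_tens(1)[of H "conj_arrow H g" "conj_arrow H f" "flip_bar x"]
      rho_tens(2)[of H "source f" "source g" x] f g x
    by (simp add: mor_arrow obj_space)
  also have "tens (bar (source g)) (bar (source f)) (flip_bar x) = \<tau> (source f) (source g) t"
    unfolding t by (rule tau_tens[symmetric]) (use f g x in auto)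
  finally show ?thesis .
qed

text \<open>
  Reversing and conjugating twice gives \<open>v \<mapsto> v\<^sup>-\<^sup>-\<close> in each factor, which \<open>\<sigma>\<close> removes. So
  \<open>(\<sigma> \<otimes> \<sigma>) \<circ> \<tau>\<close> is a left inverse of \<open>\<tau>\<close>, and by the lemma that follows also a right inverse.
\<close>

lemma sigma_tau_tau:
  assumes V: "V \<in> Obj C" and W: "W \<in> Obj C" and t: "t \<in> carrier (V \<boxtimes>\<^bsub>H\<^esub> W)"
  shows "fn (\<sigma> V \<star>\<^bsub>H\<^esub> \<sigma> W) (\<tau> (bar W) (bar V) (\<tau> V W t)) = t"
proof -
  obtain x where x: "x \<in> lists (carrier V \<times> carrier W)" and t: "t = tens V W x"
    using t by (auto simp: tensor_hmod_simps(1))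
  have x': "flip_bar x \<in> lists (carrier (bar W) \<times> carrier (bar V))"
    "flip_bar (flip_bar x) \<in> lists (carrier (bar (bar V)) \<times> carrier (bar (bar W)))"
    using x by (auto simp: in_lists_conv_set conj_hmod_simps)
  have "map (\<lambda>(v, w). (fn (\<sigma> V) v, fn (\<sigma> W) w)) (flip_bar (flip_bar x)) = x"
    using x by (auto simp: in_lists_conv_set intro!: map_idI)
  thus ?thesis
    using tensor_arrow_tens(1)[of H "\<sigma> V" "\<sigma> W" "flip_bar (flip_bar x)"] x x' V W
    by (simp add: t tau_tens mor_arrow del: map_map)
qed

lemma tau_sigma_tau:
  assumes V: "V \<in> Obj C" and W: "W \<in> Obj C" and r: "r \<in> carrier (bar W \<boxtimes>\<^bsub>H\<^esub> bar V)"
  shows "\<tau> V W (fn (\<sigma> V \<star>\<^bsub>H\<^esub> \<sigma> W) (\<tau> (bar W) (bar V) r)) = r"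
proof -
  obtain x where x: "x \<in> lists (carrier (bar W) \<times> carrier (bar V))" and r: "r = tens (bar W) (bar V) x"
    using r by (auto simp: tensor_hmod_simps(1))
  let ?y = "map (\<lambda>(v, w). (fn (\<sigma> V) v, fn (\<sigma> W) w)) (flip_bar x)"
  have x': "flip_bar x \<in> lists (carrier (bar (bar V)) \<times> carrier (bar (bar W)))"
    "?y \<in> lists (carrier V \<times> carrier W)"
    using x by (auto simp: in_lists_conv_set conj_hmod_simps)
  have "flip_bar ?y = x"
    using x by (auto simp: in_lists_conv_set conj_hmod_simps intro!: map_idI)
  thus ?thesis
    using tensor_arrow_tens(1)[of H "\<sigma> V" "\<sigma> W" "flip_bar x"] x x' V W
    by (simp add: r tau_tens mor_arrow del: map_map)
qed

lemma tau_inj: "\<lbrakk>V \<in> Obj C; W \<in> Obj C\<rbrakk> \<Longrightarrow> inj_on (\<tau> V W) (carrier (V \<boxtimes>\<^bsub>H\<^esub> W))"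
  by (rule inj_on_inverseI) (rule sigma_tau_tau)

lemma sigma_tensor_tau_closed:
  assumes "V \<in> Obj C" "W \<in> Obj C" "r \<in> carrier (bar W \<boxtimes>\<^bsub>H\<^esub> bar V)"
  shows "fn (\<sigma> V \<star>\<^bsub>H\<^esub> \<sigma> W) (\<tau> (bar W) (bar V) r) \<in> carrier (V \<boxtimes>\<^bsub>H\<^esub> W)"
  using assms mor_closed[of "\<sigma> V \<star>\<^bsub>H\<^esub> \<sigma> W"] tau_closed by simp

lemma rho_bij:
  assumes "V \<in> Obj C" "W \<in> Obj C"
  shows "bij_betw (fn (\<rho> V W)) (carrier (source (\<rho> V W))) (carrier (target (\<rho> V W)))"
  using assms
  by (intro bij_betw_byWitness[where f' = "\<lambda>r. Bar (fn (\<sigma> V \<star>\<^bsub>H\<^esub> \<sigma> W) (\<tau> (bar W) (bar V) r))"])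
    (auto simp: conj_hmod_simps(1)[of H "V \<boxtimes>\<^bsub>H\<^esub> W"] sigma_tau_tau tau_sigma_tau tau_closed
      sigma_tensor_tau_closed)

lemma rho_iso:
  assumes "V \<in> Obj C" "W \<in> Obj C"
  shows "iso_in C (\<rho> V W)" "iso_in C (inv_arrow (\<rho> V W))"
  using assms by (intro iso_in_bij rho_bij; simp)+

section \<open>Order-reversing maps on triple tensor products\<close>

abbreviation L :: "('h, 'v) hmod \<Rightarrow> ('h, 'v) hmod \<Rightarrow> ('h, 'v) hmod \<Rightarrow> 'v vec \<Rightarrow> 'v vec"
  where "L U V W t \<equiv> fn (id_arrow (bar W) \<star>\<^bsub>H\<^esub> \<rho> U V) (\<tau> (U \<boxtimes>\<^bsub>H\<^esub> V) W t)"

abbreviation R :: "('h, 'v) hmod \<Rightarrow> ('h, 'v) hmod \<Rightarrow> ('h, 'v) hmod \<Rightarrow> 'v vec \<Rightarrow> 'v vec"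
  where "R U V W t \<equiv> fn (\<rho> V W \<star>\<^bsub>H\<^esub> id_arrow (bar U)) (\<tau> U (V \<boxtimes>\<^bsub>H\<^esub> W) t)"

lemma L_closed:
  assumes "U \<in> Obj C" "V \<in> Obj C" "W \<in> Obj C" "t \<in> carrier ((U \<boxtimes>\<^bsub>H\<^esub> V) \<boxtimes>\<^bsub>H\<^esub> W)"
  shows "L U V W t \<in> carrier (bar W \<boxtimes>\<^bsub>H\<^esub> (bar V \<boxtimes>\<^bsub>H\<^esub> bar U))"
  using assms mor_closed[of "id_arrow (bar W) \<star>\<^bsub>H\<^esub> \<rho> U V"] tau_closed by simp

lemma R_closed:
  assumes "U \<in> Obj C" "V \<in> Obj C" "W \<in> Obj C" "t \<in> carrier (U \<boxtimes>\<^bsub>H\<^esub> (V \<boxtimes>\<^bsub>H\<^esub> W))"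
  shows "R U V W t \<in> carrier ((bar W \<boxtimes>\<^bsub>H\<^esub> bar V) \<boxtimes>\<^bsub>H\<^esub> bar U)"
  using assms mor_closed[of "\<rho> V W \<star>\<^bsub>H\<^esub> id_arrow (bar U)"] tau_closed by simp

lemma id_iso: "V \<in> Obj C \<Longrightarrow> iso_in C (id_arrow V)"
  unfolding iso_in_def using mor_comp_id[of "id_arrow V" V] by (intro conjI bexI[of _ "id_arrow V"]) auto

lemma L_inj:
  assumes "U \<in> Obj C" "V \<in> Obj C" "W \<in> Obj C"
  shows "inj_on (L U V W) (carrier ((U \<boxtimes>\<^bsub>H\<^esub> V) \<boxtimes>\<^bsub>H\<^esub> W))"
proof -
  have "inj_on (fn (id_arrow (bar W) \<star>\<^bsub>H\<^esub> \<rho> U V)) (carrier (bar W \<boxtimes>\<^bsub>H\<^esub> bar (U \<boxtimes>\<^bsub>H\<^esub> V)))"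
    using iso_in_bij_betw[OF iso_in_tensor[OF id_iso rho_iso(1)]] assms
    by (simp add: bij_betw_def)
  thus ?thesis
    using assms tau_inj[of "U \<boxtimes>\<^bsub>H\<^esub> V" W] tau_closed[of "U \<boxtimes>\<^bsub>H\<^esub> V" W]
    unfolding inj_on_def by (metis tensor_obj)
qed

lemma R_inj:
  assumes "U \<in> Obj C" "V \<in> Obj C" "W \<in> Obj C"
  shows "inj_on (R U V W) (carrier (U \<boxtimes>\<^bsub>H\<^esub> (V \<boxtimes>\<^bsub>H\<^esub> W)))"
proof -
  have "inj_on (fn (\<rho> V W \<star>\<^bsub>H\<^esub> id_arrow (bar U))) (carrier (bar (V \<boxtimes>\<^bsub>H\<^esub> W) \<boxtimes>\<^bsub>H\<^esub> bar U))"
    using iso_in_bij_betw[OF iso_in_tensor[OF rho_iso(1) id_iso]] assms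
    by (simp add: bij_betw_def)
  thus ?thesis
    using assms tau_inj[of U "V \<boxtimes>\<^bsub>H\<^esub> W"] tau_closed[of U "V \<boxtimes>\<^bsub>H\<^esub> W"]
    unfolding inj_on_def by (metis tensor_obj)
qed

lemma assoc_closed:
  assumes "U \<in> Obj C" "V \<in> Obj C" "W \<in> Obj C" "t \<in> carrier ((U \<boxtimes>\<^bsub>H\<^esub> V) \<boxtimes>\<^bsub>H\<^esub> W)"
  shows "fn (\<alpha> U V W) t \<in> carrier (U \<boxtimes>\<^bsub>H\<^esub> (V \<boxtimes>\<^bsub>H\<^esub> W))"
proof -
  obtain l where "l \<in> lists (carrier U \<times> carrier V \<times> carrier W)"
    and "t = tens (U \<boxtimes>\<^bsub>H\<^esub> V) W (triples_left U V l)"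
    using tensor_triples_left[of t U H V W] assms by (auto simp: obj_space)
  thus ?thesis
    using assms assoc_triples[of U V W H l] triples_lists(2)[of l U V W H]
    by (simp add: obj_space)
qed

text \<open>
  On \<open>(u \<otimes> v) \<otimes> w\<close> both sides are \<open>w\<^sup>- \<otimes> (v\<^sup>- \<otimes> u\<^sup>-)\<close>, and these elements span.
\<close>

lemma assoc_R_assoc:
  assumes U: "U \<in> Obj C" and V: "V \<in> Obj C" and W: "W \<in> Obj C"
    and t: "t \<in> carrier ((U \<boxtimes>\<^bsub>H\<^esub> V) \<boxtimes>\<^bsub>H\<^esub> W)"
  shows "fn (\<alpha> (bar W) (bar V) (bar U)) (R U V W (fn (\<alpha> U V W) t)) = L U V W t"
proof -
  let ?UV = "U \<boxtimes>\<^bsub>H\<^esub> V" and ?VW = "V \<boxtimes>\<^bsub>H\<^esub> W"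
    and ?VU' = "bar V \<boxtimes>\<^bsub>H\<^esub> bar U" and ?WV' = "bar W \<boxtimes>\<^bsub>H\<^esub> bar V"
  obtain l where l: "l \<in> lists (carrier U \<times> carrier V \<times> carrier W)"
    and t_eq: "t = tens ?UV W (triples_left U V l)"
    using tensor_triples_left[of t U H V W] assms by (auto simp: obj_space)
  define k where "k = map (\<lambda>(u, v, w). (Bar w, Bar v, Bar u)) l"
  have k: "k \<in> lists (carrier (bar W) \<times> carrier (bar V) \<times> carrier (bar U))"
    using l by (auto simp: k_def in_lists_conv_set conj_hmod_simps(1))
  have flip_right: "flip_bar (triples_right V W l) =
      map (\<lambda>(u, v, w). (Bar (tens V W [(v, w)]), Bar u)) l"
    and flip_left: "flip_bar (triples_left U V l) =
      map (\<lambda>(u, v, w). (Bar w, Bar (tens U V [(u, v)]))) l"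
    by auto
  have right: "R U V W (fn (\<alpha> U V W) t) = tens ?WV' (bar U) (triples_left (bar W) (bar V) k)"
  proof -
    have "\<tau> U ?VW (fn (\<alpha> U V W) t) = tens (bar ?VW) (bar U) (flip_bar (triples_right V W l))"
      unfolding t_eq using U V W l
      by (simp add: assoc_triples obj_space tau_tens triples_lists(2) del: map_map)
    moreover have "flip_bar (triples_right V W l) \<in> lists (carrier (bar ?VW) \<times> carrier (bar U))"
      using rho_tens(2)[of H U ?VW "triples_right V W l"] triples_lists(2)[OF l] U V W
      by (simp add: obj_space)
    moreover have "map (\<lambda>(v, w). (fn (\<rho> V W) v, fn (id_arrow (bar U)) w))
        (flip_bar (triples_right V W l)) = triples_left (bar W) (bar V) k"
      using l V W unfolding flip_right k_def
      by (auto simp: in_lists_conv_set tau_tens conj_hmod_simps(1))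
    ultimately show ?thesis
      using tensor_arrow_tens(1)[of H "\<rho> V W" "id_arrow (bar U)" "flip_bar (triples_right V W l)"] U V W
      by (simp add: mor_arrow del: map_map)
  qed
  have left: "L U V W t = tens (bar W) ?VU' (triples_right (bar V) (bar U) k)"
  proof -
    have "\<tau> ?UV W t = tens (bar W) (bar ?UV) (flip_bar (triples_left U V l))"
      unfolding t_eq using U V W l
      by (simp add: tau_tens triples_lists(1) del: map_map)
    moreover have "flip_bar (triples_left U V l) \<in> lists (carrier (bar W) \<times> carrier (bar ?UV))"
      using rho_tens(2)[of H ?UV W "triples_left U V l"] triples_lists(1)[OF l] U V W
      by (simp add: obj_space)
    moreover have "map (\<lambda>(v, w). (fn (id_arrow (bar W)) v, fn (\<rho> U V) w))
        (flip_bar (triples_left U V l)) = triples_right (bar V) (bar U) k"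
      using l U V unfolding flip_left k_def
      by (auto simp: in_lists_conv_set tau_tens conj_hmod_simps(1))
    ultimately show ?thesis
      using tensor_arrow_tens(1)[of H "id_arrow (bar W)" "\<rho> U V" "flip_bar (triples_left U V l)"] U V W
      by (simp add: mor_arrow del: map_map)
  qed
  show ?thesis
    unfolding right left using U V W k by (simp add: assoc_triples obj_space)
qed

text \<open>
  Injectivity follows from that of \<open>L = \<alpha> \<circ> R \<circ> \<alpha>\<close>, surjectivity from the spanning set
  \<open>u \<otimes> (v \<otimes> w)\<close> of the target.
\<close>

lemma assoc_bij:
  assumes U: "U \<in> Obj C" and V: "V \<in> Obj C" and W: "W \<in> Obj C"
  shows "bij_betw (fn (\<alpha> U V W)) (carrier (source (\<alpha> U V W))) (carrier (target (\<alpha> U V W)))"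
  unfolding bij_betw_def arrow_simps
proof
  show "inj_on (fn (\<alpha> U V W)) (carrier ((U \<boxtimes>\<^bsub>H\<^esub> V) \<boxtimes>\<^bsub>H\<^esub> W))"
  proof (rule inj_onI)
    fix s t
    assume s: "s \<in> carrier ((U \<boxtimes>\<^bsub>H\<^esub> V) \<boxtimes>\<^bsub>H\<^esub> W)" and t: "t \<in> carrier ((U \<boxtimes>\<^bsub>H\<^esub> V) \<boxtimes>\<^bsub>H\<^esub> W)"
      and eq: "fn (\<alpha> U V W) s = fn (\<alpha> U V W) t"
    have "L U V W s = L U V W t"
      using assoc_R_assoc[OF U V W s] assoc_R_assoc[OF U V W t] eq by simp
    thus "s = t"
      by (rule inj_onD[OF L_inj[OF U V W] _ s t])
  qed
  show "fn (\<alpha> U V W) ` carrier ((U \<boxtimes>\<^bsub>H\<^esub> V) \<boxtimes>\<^bsub>H\<^esub> W) = carrier (U \<boxtimes>\<^bsub>H\<^esub> (V \<boxtimes>\<^bsub>H\<^esub> W))"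
  proof
    show "fn (\<alpha> U V W) ` carrier ((U \<boxtimes>\<^bsub>H\<^esub> V) \<boxtimes>\<^bsub>H\<^esub> W) \<subseteq> carrier (U \<boxtimes>\<^bsub>H\<^esub> (V \<boxtimes>\<^bsub>H\<^esub> W))"
      using assoc_closed[OF U V W] by blast
    show "carrier (U \<boxtimes>\<^bsub>H\<^esub> (V \<boxtimes>\<^bsub>H\<^esub> W)) \<subseteq> fn (\<alpha> U V W) ` carrier ((U \<boxtimes>\<^bsub>H\<^esub> V) \<boxtimes>\<^bsub>H\<^esub> W)"
    proof
      fix t assume "t \<in> carrier (U \<boxtimes>\<^bsub>H\<^esub> (V \<boxtimes>\<^bsub>H\<^esub> W))"
      then obtain l where l: "l \<in> lists (carrier U \<times> carrier V \<times> carrier W)"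
        and t: "t = tens U (V \<boxtimes>\<^bsub>H\<^esub> W) (triples_right V W l)"
        using tensor_triples_right[of U V H W t] U V W by (auto simp: obj_space)
      show "t \<in> fn (\<alpha> U V W) ` carrier ((U \<boxtimes>\<^bsub>H\<^esub> V) \<boxtimes>\<^bsub>H\<^esub> W)"
        using assoc_triples[of U V W H l] triples_lists(1)[OF l] U V W l
        by (intro rev_image_eqI[of "tens (U \<boxtimes>\<^bsub>H\<^esub> V) W (triples_left U V l)"])
          (auto simp: t obj_space)
    qed
  qed
qed

abbreviation \<alpha>' :: "('h, 'v) hmod \<Rightarrow> ('h, 'v) hmod \<Rightarrow> ('h, 'v) hmod \<Rightarrow> ('h, 'v) arrow"
  where "\<alpha>' U V W \<equiv> inv_arrow (\<alpha> U V W)"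

lemma inv_assoc_fn:
  assumes "U \<in> Obj C" "V \<in> Obj C" "W \<in> Obj C"
  shows "t \<in> carrier ((U \<boxtimes>\<^bsub>H\<^esub> V) \<boxtimes>\<^bsub>H\<^esub> W) \<Longrightarrow> fn (\<alpha>' U V W) (fn (\<alpha> U V W) t) = t"
    and "s \<in> carrier (U \<boxtimes>\<^bsub>H\<^esub> (V \<boxtimes>\<^bsub>H\<^esub> W)) \<Longrightarrow> fn (\<alpha> U V W) (fn (\<alpha>' U V W) s) = s"
    and "s \<in> carrier (U \<boxtimes>\<^bsub>H\<^esub> (V \<boxtimes>\<^bsub>H\<^esub> W)) \<Longrightarrow>
      fn (\<alpha>' U V W) s \<in> carrier ((U \<boxtimes>\<^bsub>H\<^esub> V) \<boxtimes>\<^bsub>H\<^esub> W)"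
  using inv_arrow_fn[OF assoc_bij[OF assms]] by simp_all

lemma R_assoc:
  assumes "U \<in> Obj C" "V \<in> Obj C" "W \<in> Obj C" "t \<in> carrier ((U \<boxtimes>\<^bsub>H\<^esub> V) \<boxtimes>\<^bsub>H\<^esub> W)"
  shows "R U V W (fn (\<alpha> U V W) t) = fn (\<alpha>' (bar W) (bar V) (bar U)) (L U V W t)"
  using assms
  by (simp add: inv_assoc_fn(1) R_closed assoc_closed flip: assoc_R_assoc)

text \<open>
  The hypothesis on \<open>f\<close> and \<open>g\<close> says that \<open>\<tau> \<circ> f = g \<circ> \<tau>\<close>; then \<open>L\<close> turns \<open>f \<otimes> id\<close> into
  \<open>id \<otimes> g\<close>. It is applied to \<open>f = \<phi> U V\<close>.
\<close>

lemma L_tensor_id: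
  assumes f: "f \<in> Mor C" "source f = U \<boxtimes>\<^bsub>H\<^esub> V" "target f = U' \<boxtimes>\<^bsub>H\<^esub> V'" and g: "g \<in> Mor C"
    and obj: "U \<in> Obj C" "V \<in> Obj C" "U' \<in> Obj C" "V' \<in> Obj C" "W \<in> Obj C"
    and gf: "source g = bar V \<boxtimes>\<^bsub>H\<^esub> bar U" "\<rho> U' V' \<bullet> conj_arrow H f = g \<bullet> \<rho> U V"
    and t: "t \<in> carrier ((U \<boxtimes>\<^bsub>H\<^esub> V) \<boxtimes>\<^bsub>H\<^esub> W)"
  shows "L U' V' W (fn (f \<star>\<^bsub>H\<^esub> id_arrow W) t) = fn (id_arrow (bar W) \<star>\<^bsub>H\<^esub> g) (L U V W t)"
proof -
  have \<tau>: "\<tau> (U \<boxtimes>\<^bsub>H\<^esub> V) W t \<in> carrier (bar W \<boxtimes>\<^bsub>H\<^esub> bar (U \<boxtimes>\<^bsub>H\<^esub> V))"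
    using t obj by (simp add: tau_closed)
  have "\<tau> (U' \<boxtimes>\<^bsub>H\<^esub> V') W (fn (f \<star>\<^bsub>H\<^esub> id_arrow W) t) =
      fn (id_arrow (bar W) \<star>\<^bsub>H\<^esub> conj_arrow H f) (\<tau> (U \<boxtimes>\<^bsub>H\<^esub> V) W t)"
    using tau_natural[of f "id_arrow W" t] f obj t by (simp add: conj_arrow_id)
  thus ?thesis
    using f obj g gf \<tau> by (simp add: tensor_comp_fn)
qed

lemma R_id_tensor:
  assumes f: "f \<in> Mor C" "source f = V \<boxtimes>\<^bsub>H\<^esub> W" "target f = V' \<boxtimes>\<^bsub>H\<^esub> W'" and g: "g \<in> Mor C"
    and obj: "V \<in> Obj C" "W \<in> Obj C" "V' \<in> Obj C" "W' \<in> Obj C" "U \<in> Obj C"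
    and gf: "source g = bar W \<boxtimes>\<^bsub>H\<^esub> bar V" "\<rho> V' W' \<bullet> conj_arrow H f = g \<bullet> \<rho> V W"
    and t: "t \<in> carrier (U \<boxtimes>\<^bsub>H\<^esub> (V \<boxtimes>\<^bsub>H\<^esub> W))"
  shows "R U V' W' (fn (id_arrow U \<star>\<^bsub>H\<^esub> f) t) = fn (g \<star>\<^bsub>H\<^esub> id_arrow (bar U)) (R U V W t)"
proof -
  have \<tau>: "\<tau> U (V \<boxtimes>\<^bsub>H\<^esub> W) t \<in> carrier (bar (V \<boxtimes>\<^bsub>H\<^esub> W) \<boxtimes>\<^bsub>H\<^esub> bar U)"
    using t obj by (simp add: tau_closed)
  have "\<tau> U (V' \<boxtimes>\<^bsub>H\<^esub> W') (fn (id_arrow U \<star>\<^bsub>H\<^esub> f) t) =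
      fn (conj_arrow H f \<star>\<^bsub>H\<^esub> id_arrow (bar U)) (\<tau> U (V \<boxtimes>\<^bsub>H\<^esub> W) t)"
    using tau_natural[of "id_arrow U" f t] f obj t by (simp add: conj_arrow_id)
  thus ?thesis
    using f obj g gf \<tau> by (simp add: tensor_comp_fn)
qed

end

section \<open>The conjugate braiding\<close>

locale braided_conjugation_category = conjugation_category H C
  for H :: "'h hopf_algebra" and C :: "('h, 'v) subcategory" +
  fixes \<psi> :: "('h, 'v) hmod \<Rightarrow> ('h, 'v) hmod \<Rightarrow> ('h, 'v) arrow"
  assumes braiding: "braiding H C \<psi>"
begin

abbreviation \<phi> :: "('h, 'v) hmod \<Rightarrow> ('h, 'v) hmod \<Rightarrow> ('h, 'v) arrow"
  where "\<phi> \<equiv> conjugate_braiding H \<psi>"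

lemma psi_iso: "\<lbrakk>V \<in> Obj C; W \<in> Obj C\<rbrakk> \<Longrightarrow> iso_in C (\<psi> V W)"
  and psi_simps [simp]: "\<lbrakk>V \<in> Obj C; W \<in> Obj C\<rbrakk> \<Longrightarrow> source (\<psi> V W) = V \<boxtimes>\<^bsub>H\<^esub> W"
    "\<lbrakk>V \<in> Obj C; W \<in> Obj C\<rbrakk> \<Longrightarrow> target (\<psi> V W) = W \<boxtimes>\<^bsub>H\<^esub> V"
  and psi_tensor_right: "\<lbrakk>U \<in> Obj C; V \<in> Obj C; W \<in> Obj C\<rbrakk> \<Longrightarrow> \<psi> U (V \<boxtimes>\<^bsub>H\<^esub> W) =
    \<alpha>' V W U \<bullet> (id_arrow V \<star>\<^bsub>H\<^esub> \<psi> U W) \<bullet> \<alpha> V U W \<bullet> (\<psi> U V \<star>\<^bsub>H\<^esub> id_arrow W) \<bullet> \<alpha>' U V W"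
  and psi_tensor_left: "\<lbrakk>U \<in> Obj C; V \<in> Obj C; W \<in> Obj C\<rbrakk> \<Longrightarrow> \<psi> (U \<boxtimes>\<^bsub>H\<^esub> V) W =
    \<alpha> W U V \<bullet> (\<psi> U W \<star>\<^bsub>H\<^esub> id_arrow V) \<bullet> \<alpha>' U W V \<bullet> (id_arrow U \<star>\<^bsub>H\<^esub> \<psi> V W) \<bullet> \<alpha> U V W"
  and psi_natural: "\<lbrakk>f \<in> Mor C; g \<in> Mor C\<rbrakk> \<Longrightarrow>
    \<psi> (target f) (target g) \<bullet> (f \<star>\<^bsub>H\<^esub> g) = (g \<star>\<^bsub>H\<^esub> f) \<bullet> \<psi> (source f) (source g)"
  using braiding unfolding braiding_def by blast+

lemma psi_mor [simp]: "\<lbrakk>V \<in> Obj C; W \<in> Obj C\<rbrakk> \<Longrightarrow> \<psi> V W \<in> Mor C"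
  using psi_iso by (auto simp: iso_in_def)

lemma psi_closed:
  "\<lbrakk>V \<in> Obj C; W \<in> Obj C; t \<in> carrier (V \<boxtimes>\<^bsub>H\<^esub> W)\<rbrakk> \<Longrightarrow> fn (\<psi> V W) t \<in> carrier (W \<boxtimes>\<^bsub>H\<^esub> V)"
  using mor_closed[of "\<psi> V W" t] by simp

lemma psi_natural_fn:
  assumes "f \<in> Mor C" "g \<in> Mor C" "t \<in> carrier (source f \<boxtimes>\<^bsub>H\<^esub> source g)"
  shows "fn (g \<star>\<^bsub>H\<^esub> f) (fn (\<psi> (source f) (source g)) t) =
    fn (\<psi> (target f) (target g)) (fn (f \<star>\<^bsub>H\<^esub> g) t)"
proof -
  have "fn (g \<star>\<^bsub>H\<^esub> f) (fn (\<psi> (source f) (source g)) t) =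
      fn ((g \<star>\<^bsub>H\<^esub> f) \<bullet> \<psi> (source f) (source g)) t"
    using assms by simp
  also have "\<dots> = fn (\<psi> (target f) (target g) \<bullet> (f \<star>\<^bsub>H\<^esub> g)) t"
    using assms by (simp add: psi_natural)
  also have "\<dots> = fn (\<psi> (target f) (target g)) (fn (f \<star>\<^bsub>H\<^esub> g) t)"
    using assms by simp
  finally show ?thesis .
qed

lemma phi_simps [simp]: "source (\<phi> V W) = V \<boxtimes>\<^bsub>H\<^esub> W" "target (\<phi> V W) = W \<boxtimes>\<^bsub>H\<^esub> V"
  by (simp_all add: conjugate_braiding_def)

lemma phi_iso:
  assumes "V \<in> Obj C" "W \<in> Obj C"
  shows "iso_in C (\<phi> V W)"
  unfolding conjugate_braiding_def xi_arrow_def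
  using assms
  by (intro iso_in_comp iso_in_tensor iso_in_conj rho_iso sigma_iso psi_iso) simp_all

lemma phi_mor [simp]: "\<lbrakk>V \<in> Obj C; W \<in> Obj C\<rbrakk> \<Longrightarrow> \<phi> V W \<in> Mor C"
  using phi_iso by (auto simp: iso_in_def)

lemma phi_closed:
  "\<lbrakk>V \<in> Obj C; W \<in> Obj C; t \<in> carrier (V \<boxtimes>\<^bsub>H\<^esub> W)\<rbrakk> \<Longrightarrow> fn (\<phi> V W) t \<in> carrier (W \<boxtimes>\<^bsub>H\<^esub> V)"
  using mor_closed[of "\<phi> V W" t] by simp

text \<open>
  In the definition of \<open>\<phi>\<close>, the first two factors \<open>\<rho>\<^sup>-\<^sup>1 \<circ> (\<sigma>\<^sup>-\<^sup>1 \<otimes> \<sigma>\<^sup>-\<^sup>1)\<close> send \<open>t\<close> to the bar of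
  \<open>\<tau> t\<close>, and the last two send the bar of an element to its preimage under \<open>\<tau>\<close>.
\<close>

lemma tau_phi:
  assumes V: "V \<in> Obj C" and W: "W \<in> Obj C" and t: "t \<in> carrier (V \<boxtimes>\<^bsub>H\<^esub> W)"
  shows "\<tau> W V (fn (\<phi> V W) t) = fn (\<psi> (bar W) (bar V)) (\<tau> V W t)"
proof -
  let ?r = "\<tau> V W t" and ?s = "fn (inv_arrow (\<sigma> V) \<star>\<^bsub>H\<^esub> inv_arrow (\<sigma> W)) t"
  have r: "?r \<in> carrier (bar W \<boxtimes>\<^bsub>H\<^esub> bar V)"
    using assms by (rule tau_closed)
  have rr: "\<tau> (bar W) (bar V) ?r \<in> carrier (bar (bar V) \<boxtimes>\<^bsub>H\<^esub> bar (bar W))"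
    by (rule tau_closed[OF conj_obj[OF W] conj_obj[OF V] r])
  have "?s = fn (inv_arrow (\<sigma> V) \<star>\<^bsub>H\<^esub> inv_arrow (\<sigma> W)) (fn (\<sigma> V \<star>\<^bsub>H\<^esub> \<sigma> W) (\<tau> (bar W) (bar V) ?r))"
    by (simp only: sigma_tau_tau[OF assms])
  also have "\<dots> = \<tau> (bar W) (bar V) ?r"
    using V W rr
    by (simp add: tensor_comp_fn inv_arrow_comp[OF sigma_bij] tensor_id)
  finally have s: "?s = \<tau> (bar W) (bar V) ?r" .
  have Bar: "Bar ?r \<in> carrier (source (\<rho> (bar W) (bar V)))"
    using r by (simp add: conj_hmod_simps(1)[of H "bar W \<boxtimes>\<^bsub>H\<^esub> bar V"])
  have "fn (inv_arrow (\<rho> (bar W) (bar V))) ?s = Bar ?r"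
    unfolding s using V W Bar by (intro inv_arrow_fn(1) rho_bij) simp_all
  moreover have "?s \<in> carrier (bar (bar V) \<boxtimes>\<^bsub>H\<^esub> bar (bar W))"
    unfolding s by (rule rr)
  moreover have "fn (conj_arrow H (\<psi> (bar W) (bar V))) (Bar ?r) = Bar (fn (\<psi> (bar W) (bar V)) ?r)"
    using V W r by simp
  ultimately have "fn (\<phi> V W) t =
      fn (\<sigma> W \<star>\<^bsub>H\<^esub> \<sigma> V) (\<tau> (bar V) (bar W) (fn (\<psi> (bar W) (bar V)) ?r))"
    using t by (simp add: conjugate_braiding_def xi_arrow_def)
  thus ?thesis
    using V W r t by (simp add: tau_sigma_tau psi_closed)
qed

lemma rho_conj_phi:
  assumes "V \<in> Obj C" "W \<in> Obj C"
  shows "\<rho> W V \<bullet> conj_arrow H (\<phi> V W) = \<psi> (bar W) (bar V) \<bullet> \<rho> V W"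
  using assms fn_extensional(1)[of "\<rho> W V" "conj_arrow H (\<phi> V W)"]
    fn_extensional(1)[of "\<psi> (bar W) (bar V)" "\<rho> V W"]
  by (intro arrow_eqI) (auto simp: tau_phi conj_hmod_simps(1)[of H "V \<boxtimes>\<^bsub>H\<^esub> W"])

lemma L_phi:
  assumes "U \<in> Obj C" "V \<in> Obj C" "W \<in> Obj C" "t \<in> carrier ((U \<boxtimes>\<^bsub>H\<^esub> V) \<boxtimes>\<^bsub>H\<^esub> W)"
  shows "L V U W (fn (\<phi> U V \<star>\<^bsub>H\<^esub> id_arrow W) t) =
    fn (id_arrow (bar W) \<star>\<^bsub>H\<^esub> \<psi> (bar V) (bar U)) (L U V W t)"
  using assms by (intro L_tensor_id) (simp_all add: rho_conj_phi)

lemma R_phi: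
  assumes "U \<in> Obj C" "V \<in> Obj C" "W \<in> Obj C" "t \<in> carrier (U \<boxtimes>\<^bsub>H\<^esub> (V \<boxtimes>\<^bsub>H\<^esub> W))"
  shows "R U W V (fn (id_arrow U \<star>\<^bsub>H\<^esub> \<phi> V W) t) =
    fn (\<psi> (bar W) (bar V) \<star>\<^bsub>H\<^esub> id_arrow (bar U)) (R U V W t)"
  using assms by (intro R_id_tensor) (simp_all add: rho_conj_phi)

lemma phi_id_closed:
  assumes "U \<in> Obj C" "V \<in> Obj C" "W \<in> Obj C"
  shows "t \<in> carrier ((U \<boxtimes>\<^bsub>H\<^esub> V) \<boxtimes>\<^bsub>H\<^esub> W) \<Longrightarrow>
      fn (\<phi> U V \<star>\<^bsub>H\<^esub> id_arrow W) t \<in> carrier ((V \<boxtimes>\<^bsub>H\<^esub> U) \<boxtimes>\<^bsub>H\<^esub> W)"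
    and "t \<in> carrier (U \<boxtimes>\<^bsub>H\<^esub> (V \<boxtimes>\<^bsub>H\<^esub> W)) \<Longrightarrow>
      fn (id_arrow U \<star>\<^bsub>H\<^esub> \<phi> V W) t \<in> carrier (U \<boxtimes>\<^bsub>H\<^esub> (W \<boxtimes>\<^bsub>H\<^esub> V))"
  using assms mor_closed[of "\<phi> U V \<star>\<^bsub>H\<^esub> id_arrow W" t] mor_closed[of "id_arrow U \<star>\<^bsub>H\<^esub> \<phi> V W" t]
  by simp_all

text \<open>
  Since \<open>R\<close> is injective, it is enough to compare the images under \<open>R\<close> of \<open>\<alpha> (\<phi> U (V \<otimes> W) t)\<close> and
  \<open>(id \<otimes> \<phi> U W) (\<alpha> ((\<phi> U V \<otimes> id) t))\<close>. The first one involves \<open>\<psi> (W\<^sup>- \<otimes> V\<^sup>-) U\<^sup>-\<close>, which the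
  hexagon for a tensor product on the left decomposes.
\<close>

lemma phi_tensor_right:
  assumes U: "U \<in> Obj C" and V: "V \<in> Obj C" and W: "W \<in> Obj C"
  shows "\<phi> U (V \<boxtimes>\<^bsub>H\<^esub> W) =
    \<alpha>' V W U \<bullet> (id_arrow V \<star>\<^bsub>H\<^esub> \<phi> U W) \<bullet> \<alpha> V U W \<bullet> (\<phi> U V \<star>\<^bsub>H\<^esub> id_arrow W) \<bullet> \<alpha>' U V W"
    (is "_ = ?rhs\<^sub>1 \<bullet> ?rhs\<^sub>2")
proof (rule arrow_eqI)
  fix t\<^sub>0 assume "t\<^sub>0 \<in> carrier (source (\<phi> U (V \<boxtimes>\<^bsub>H\<^esub> W)))"
  hence t0: "t\<^sub>0 \<in> carrier (U \<boxtimes>\<^bsub>H\<^esub> (V \<boxtimes>\<^bsub>H\<^esub> W))" by simp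
  define t where "t = fn (\<alpha>' U V W) t\<^sub>0"
  have t: "t \<in> carrier ((U \<boxtimes>\<^bsub>H\<^esub> V) \<boxtimes>\<^bsub>H\<^esub> W)" and \<alpha>t: "fn (\<alpha> U V W) t = t\<^sub>0"
    using inv_assoc_fn(2,3)[OF U V W t0] by (auto simp: t_def)
  let ?s = "fn (\<phi> U V \<star>\<^bsub>H\<^esub> id_arrow W) t"
  let ?q = "fn (id_arrow V \<star>\<^bsub>H\<^esub> \<phi> U W) (fn (\<alpha> V U W) ?s)"
  let ?y = "fn (\<phi> U (V \<boxtimes>\<^bsub>H\<^esub> W)) t\<^sub>0"
  have s: "?s \<in> carrier ((V \<boxtimes>\<^bsub>H\<^esub> U) \<boxtimes>\<^bsub>H\<^esub> W)" and \<alpha>s: "fn (\<alpha> V U W) ?s \<in> carrier (V \<boxtimes>\<^bsub>H\<^esub> (U \<boxtimes>\<^bsub>H\<^esub> W))"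
    and q: "?q \<in> carrier (V \<boxtimes>\<^bsub>H\<^esub> (W \<boxtimes>\<^bsub>H\<^esub> U))" and y: "?y \<in> carrier ((V \<boxtimes>\<^bsub>H\<^esub> W) \<boxtimes>\<^bsub>H\<^esub> U)"
    using U V W t t0 by (simp_all add: phi_id_closed assoc_closed phi_closed)
  have Lt: "L U V W t \<in> carrier (bar W \<boxtimes>\<^bsub>H\<^esub> (bar V \<boxtimes>\<^bsub>H\<^esub> bar U))"
    and Rt0: "R U V W t\<^sub>0 \<in> carrier ((bar W \<boxtimes>\<^bsub>H\<^esub> bar V) \<boxtimes>\<^bsub>H\<^esub> bar U)"
    using U V W t t0 by (simp_all add: L_closed R_closed)
  let ?h = "fn (\<psi> (bar W) (bar U) \<star>\<^bsub>H\<^esub> id_arrow (bar V))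
    (fn (\<alpha>' (bar W) (bar U) (bar V)) (fn (id_arrow (bar W) \<star>\<^bsub>H\<^esub> \<psi> (bar V) (bar U)) (L U V W t)))"
  have "R V W U (fn (\<alpha> V W U) ?y) = fn (\<alpha>' (bar U) (bar W) (bar V)) (L V W U ?y)"
    using U V W y by (intro R_assoc)
  also have "L V W U ?y = fn (id_arrow (bar U) \<star>\<^bsub>H\<^esub> \<rho> V W)
      (fn (\<psi> (bar (V \<boxtimes>\<^bsub>H\<^esub> W)) (bar U)) (\<tau> U (V \<boxtimes>\<^bsub>H\<^esub> W) t\<^sub>0))"
    using U V W t0 by (simp add: tau_phi)
  also have "\<dots> = fn (\<psi> (bar W \<boxtimes>\<^bsub>H\<^esub> bar V) (bar U)) (R U V W t\<^sub>0)"
    using psi_natural_fn[of "\<rho> V W" "id_arrow (bar U)" "\<tau> U (V \<boxtimes>\<^bsub>H\<^esub> W) t\<^sub>0"] U V W t0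
    by (simp add: tau_closed)
  also have "\<dots> = fn (\<alpha> (bar U) (bar W) (bar V)) ?h"
    using U V W Rt0 t assoc_R_assoc[OF U V W t]
    by (simp add: psi_tensor_left \<alpha>t)
  also have "fn (\<alpha>' (bar U) (bar W) (bar V)) \<dots> = ?h"
  proof (rule inv_assoc_fn(1))
    have "fn (id_arrow (bar W) \<star>\<^bsub>H\<^esub> \<psi> (bar V) (bar U)) (L U V W t) \<in>
        carrier (bar W \<boxtimes>\<^bsub>H\<^esub> (bar U \<boxtimes>\<^bsub>H\<^esub> bar V))"
      using mor_closed[of "id_arrow (bar W) \<star>\<^bsub>H\<^esub> \<psi> (bar V) (bar U)" "L U V W t"] U V W Lt by simp
    hence "fn (\<alpha>' (bar W) (bar U) (bar V)) (fn (id_arrow (bar W) \<star>\<^bsub>H\<^esub> \<psi> (bar V) (bar U)) (L U V W t))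
        \<in> carrier ((bar W \<boxtimes>\<^bsub>H\<^esub> bar U) \<boxtimes>\<^bsub>H\<^esub> bar V)"
      using U V W by (simp add: inv_assoc_fn(3))
    thus "?h \<in> carrier ((bar U \<boxtimes>\<^bsub>H\<^esub> bar W) \<boxtimes>\<^bsub>H\<^esub> bar V)"
      using mor_closed[of "\<psi> (bar W) (bar U) \<star>\<^bsub>H\<^esub> id_arrow (bar V)"] U V W by simp
  qed (use U V W in simp_all)
  also have "?h = R V W U ?q"
    using U V W t s \<alpha>s by (simp add: R_phi R_assoc L_phi)
  finally have "R V W U (fn (\<alpha> V W U) ?y) = R V W U ?q" .
  hence "fn (\<alpha> V W U) ?y = ?q"
    by (rule inj_onD[OF R_inj[OF V W U] _ assoc_closed[OF V W U y] q])
  hence "?y = fn (\<alpha>' V W U) ?q"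
    using inv_assoc_fn(1)[OF V W U y] by simp
  also have "\<dots> = fn (?rhs\<^sub>1 \<bullet> ?rhs\<^sub>2) t\<^sub>0"
    using t0 t s \<alpha>s U V W by (simp add: t_def)
  finally show "?y = fn (?rhs\<^sub>1 \<bullet> ?rhs\<^sub>2) t\<^sub>0" .
next
  show "fn (\<phi> U (V \<boxtimes>\<^bsub>H\<^esub> W)) \<in> extensional (carrier (source (\<phi> U (V \<boxtimes>\<^bsub>H\<^esub> W))))"
    using U V W by (intro hmod_arrowD(4)[OF mor_arrow]) simp
  show "fn (?rhs\<^sub>1 \<bullet> ?rhs\<^sub>2) \<in> extensional (carrier (source (\<phi> U (V \<boxtimes>\<^bsub>H\<^esub> W))))"
    using fn_extensional(1)[of "?rhs\<^sub>1" "?rhs\<^sub>2"] by simp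
qed simp_all

text \<open>
  As in the previous lemma, now with the roles of the two hexagons of \<open>\<psi>\<close> exchanged.
\<close>

lemma phi_tensor_left:
  assumes U: "U \<in> Obj C" and V: "V \<in> Obj C" and W: "W \<in> Obj C"
  shows "\<phi> (U \<boxtimes>\<^bsub>H\<^esub> V) W =
    \<alpha> W U V \<bullet> (\<phi> U W \<star>\<^bsub>H\<^esub> id_arrow V) \<bullet> \<alpha>' U W V \<bullet> (id_arrow U \<star>\<^bsub>H\<^esub> \<phi> V W) \<bullet> \<alpha> U V W"
    (is "_ = ?rhs\<^sub>1 \<bullet> ?rhs\<^sub>2")
proof (rule arrow_eqI)
  fix t assume "t \<in> carrier (source (\<phi> (U \<boxtimes>\<^bsub>H\<^esub> V) W))"
  hence t: "t \<in> carrier ((U \<boxtimes>\<^bsub>H\<^esub> V) \<boxtimes>\<^bsub>H\<^esub> W)" by simp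
  let ?s = "fn (id_arrow U \<star>\<^bsub>H\<^esub> \<phi> V W) (fn (\<alpha> U V W) t)"
  let ?p = "fn (\<phi> U W \<star>\<^bsub>H\<^esub> id_arrow V) (fn (\<alpha>' U W V) ?s)"
  let ?y = "fn (\<phi> (U \<boxtimes>\<^bsub>H\<^esub> V) W) t"
  have \<alpha>t: "fn (\<alpha> U V W) t \<in> carrier (U \<boxtimes>\<^bsub>H\<^esub> (V \<boxtimes>\<^bsub>H\<^esub> W))"
    and s: "?s \<in> carrier (U \<boxtimes>\<^bsub>H\<^esub> (W \<boxtimes>\<^bsub>H\<^esub> V))"
    and \<alpha>s: "fn (\<alpha>' U W V) ?s \<in> carrier ((U \<boxtimes>\<^bsub>H\<^esub> W) \<boxtimes>\<^bsub>H\<^esub> V)"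
    and p: "?p \<in> carrier ((W \<boxtimes>\<^bsub>H\<^esub> U) \<boxtimes>\<^bsub>H\<^esub> V)" and y: "?y \<in> carrier (W \<boxtimes>\<^bsub>H\<^esub> (U \<boxtimes>\<^bsub>H\<^esub> V))"
    using U V W t by (simp_all add: phi_id_closed assoc_closed inv_assoc_fn(3) phi_closed)
  have Lt: "L U V W t \<in> carrier (bar W \<boxtimes>\<^bsub>H\<^esub> (bar V \<boxtimes>\<^bsub>H\<^esub> bar U))"
    and R\<alpha>t: "R U V W (fn (\<alpha> U V W) t) \<in> carrier ((bar W \<boxtimes>\<^bsub>H\<^esub> bar V) \<boxtimes>\<^bsub>H\<^esub> bar U)"
    using U V W t \<alpha>t by (simp_all add: L_closed R_closed)
  let ?g = "fn (\<psi> (bar W) (bar V) \<star>\<^bsub>H\<^esub> id_arrow (bar U)) (R U V W (fn (\<alpha> U V W) t))"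
  have g: "?g \<in> carrier ((bar V \<boxtimes>\<^bsub>H\<^esub> bar W) \<boxtimes>\<^bsub>H\<^esub> bar U)"
    using mor_closed[of "\<psi> (bar W) (bar V) \<star>\<^bsub>H\<^esub> id_arrow (bar U)"] R\<alpha>t U V W by simp
  have "R W U V ?y = fn (\<rho> U V \<star>\<^bsub>H\<^esub> id_arrow (bar W))
      (fn (\<psi> (bar W) (bar (U \<boxtimes>\<^bsub>H\<^esub> V))) (\<tau> (U \<boxtimes>\<^bsub>H\<^esub> V) W t))"
    using U V W t by (simp add: tau_phi)
  also have "\<dots> = fn (\<psi> (bar W) (bar V \<boxtimes>\<^bsub>H\<^esub> bar U)) (L U V W t)"
    using psi_natural_fn[of "id_arrow (bar W)" "\<rho> U V" "\<tau> (U \<boxtimes>\<^bsub>H\<^esub> V) W t"] U V W t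
    by (simp add: tau_closed)
  also have "\<dots> = fn (\<alpha>' (bar V) (bar U) (bar W)) (fn (id_arrow (bar V) \<star>\<^bsub>H\<^esub> \<psi> (bar W) (bar U))
      (fn (\<alpha> (bar V) (bar W) (bar U)) ?g))"
    using U V W t Lt by (simp add: psi_tensor_right R_assoc)
  also have "fn (\<alpha> (bar V) (bar W) (bar U)) ?g = L U W V (fn (\<alpha>' U W V) ?s)"
    using assoc_R_assoc[OF U W V \<alpha>s] U V W \<alpha>t s by (simp add: inv_assoc_fn(2) R_phi)
  also have "fn (id_arrow (bar V) \<star>\<^bsub>H\<^esub> \<psi> (bar W) (bar U)) \<dots> = L W U V ?p"
    using U V W \<alpha>s by (simp add: L_phi)
  also have "fn (\<alpha>' (bar V) (bar U) (bar W)) \<dots> = R W U V (fn (\<alpha> W U V) ?p)"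
    using U V W p by (simp add: R_assoc)
  finally have "R W U V ?y = R W U V (fn (\<alpha> W U V) ?p)" .
  hence "?y = fn (\<alpha> W U V) ?p"
    by (rule inj_onD[OF R_inj[OF W U V] _ y assoc_closed[OF W U V p]])
  also have "\<dots> = fn (?rhs\<^sub>1 \<bullet> ?rhs\<^sub>2) t"
    using t \<alpha>t s \<alpha>s U V W by simp
  finally show "?y = fn (?rhs\<^sub>1 \<bullet> ?rhs\<^sub>2) t" .
next
  show "fn (\<phi> (U \<boxtimes>\<^bsub>H\<^esub> V) W) \<in> extensional (carrier (source (\<phi> (U \<boxtimes>\<^bsub>H\<^esub> V) W)))"
    using U V W by (intro hmod_arrowD(4)[OF mor_arrow]) simp
  show "fn (?rhs\<^sub>1 \<bullet> ?rhs\<^sub>2) \<in> extensional (carrier (source (\<phi> (U \<boxtimes>\<^bsub>H\<^esub> V) W)))"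
    using fn_extensional(1)[of "?rhs\<^sub>1" "?rhs\<^sub>2"] by simp
qed simp_all

lemma phi_natural:
  assumes f: "f \<in> Mor C" and g: "g \<in> Mor C"
  shows "\<phi> (target f) (target g) \<bullet> (f \<star>\<^bsub>H\<^esub> g) = (g \<star>\<^bsub>H\<^esub> f) \<bullet> \<phi> (source f) (source g)"
proof (rule arrow_eqI)
  let ?V = "source f" and ?W = "source g" and ?V' = "target f" and ?W' = "target g"
  fix t assume "t \<in> carrier (source (\<phi> ?V' ?W' \<bullet> (f \<star>\<^bsub>H\<^esub> g)))"
  hence t: "t \<in> carrier (?V \<boxtimes>\<^bsub>H\<^esub> ?W)" by simp
  have fgt: "fn (f \<star>\<^bsub>H\<^esub> g) t \<in> carrier (?V' \<boxtimes>\<^bsub>H\<^esub> ?W')"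
    using mor_closed[of "f \<star>\<^bsub>H\<^esub> g" t] f g t by simp
  have \<phi>t: "fn (\<phi> ?V ?W) t \<in> carrier (?W \<boxtimes>\<^bsub>H\<^esub> ?V)"
    using f g t by (simp add: phi_closed)
  have "\<tau> ?W' ?V' (fn (\<phi> ?V' ?W') (fn (f \<star>\<^bsub>H\<^esub> g) t)) =
      fn (\<psi> (bar ?W') (bar ?V')) (fn (conj_arrow H g \<star>\<^bsub>H\<^esub> conj_arrow H f) (\<tau> ?V ?W t))"
    using f g t fgt by (simp add: tau_phi tau_natural)
  also have "\<dots> = fn (conj_arrow H f \<star>\<^bsub>H\<^esub> conj_arrow H g) (fn (\<psi> (bar ?W) (bar ?V)) (\<tau> ?V ?W t))"
    using psi_natural_fn[of "conj_arrow H g" "conj_arrow H f" "\<tau> ?V ?W t"] f g t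
    by (simp add: tau_closed)
  also have "\<dots> = \<tau> ?W' ?V' (fn (g \<star>\<^bsub>H\<^esub> f) (fn (\<phi> ?V ?W) t))"
    using f g t \<phi>t by (simp add: tau_phi tau_natural)
  finally have eq: "\<tau> ?W' ?V' (fn (\<phi> ?V' ?W') (fn (f \<star>\<^bsub>H\<^esub> g) t)) =
      \<tau> ?W' ?V' (fn (g \<star>\<^bsub>H\<^esub> f) (fn (\<phi> ?V ?W) t))" .
  have "fn (\<phi> ?V' ?W') (fn (f \<star>\<^bsub>H\<^esub> g) t) = fn (g \<star>\<^bsub>H\<^esub> f) (fn (\<phi> ?V ?W) t)"
    by (rule inj_onD[OF tau_inj eq])
      (use f g fgt \<phi>t mor_closed[of "g \<star>\<^bsub>H\<^esub> f" "fn (\<phi> ?V ?W) t"] in \<open>simp_all add: phi_closed\<close>)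
  thus "fn (\<phi> ?V' ?W' \<bullet> (f \<star>\<^bsub>H\<^esub> g)) t = fn ((g \<star>\<^bsub>H\<^esub> f) \<bullet> \<phi> ?V ?W) t"
    using t by simp
qed (use fn_extensional(1)[of "\<phi> (target f) (target g)" "f \<star>\<^bsub>H\<^esub> g"]
      fn_extensional(1)[of "g \<star>\<^bsub>H\<^esub> f" "\<phi> (source f) (source g)"] in auto)

lemma braiding_phi: "braiding H C \<phi>"
  unfolding braiding_def
  using phi_simps phi_iso phi_tensor_right phi_tensor_left phi_natural by blast

end

theorem proposition9p6:
  fixes H :: "'h hopf_algebra"
    and C :: "('h, 'v) subcategory"
    and \<psi> :: "('h, 'v) hmod \<Rightarrow> ('h, 'v) hmod \<Rightarrow> ('h, 'v) arrow"
  assumes "hopf_star_algebra H"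
    and "sub_monoidal_category H C"
    and "braiding H C \<psi>"
    and "\<And>V. V \<in> Obj C \<Longrightarrow> conj_hmod H V \<in> Obj C"
    and "\<And>f. f \<in> Mor C \<Longrightarrow> conj_arrow H f \<in> Mor C"
    and "\<And>V W. \<lbrakk>V \<in> Obj C; W \<in> Obj C\<rbrakk> \<Longrightarrow>
      rho_arrow H V W \<in> Mor C \<and> inv_arrow (rho_arrow H V W) \<in> Mor C"
    and "\<And>V. V \<in> Obj C \<Longrightarrow>
      sigma_arrow H V \<in> Mor C \<and> inv_arrow (sigma_arrow H V) \<in> Mor C"
  shows "braiding H C (conjugate_braiding H \<psi>)"
proof -
  interpret braided_conjugation_category H C \<psi>
    by unfold_locales (use assms in auto)
  show ?thesis
    by (rule braiding_phi)
qed

end
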